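(* Let $k$ be an even positive integer and let $f\in S_k$ be a cuspidal Hecke eigenform, normalized so that $T_n f=a_n f$ for all $n\ge 1$, where $f=\sum_{n\ge1}a_nq^n$. Define the coefficients $q^f_{r,s}\in\mathbb{C}$ ($r+s=k$, $r,s\ge 1$) by $$P^{ev,0}_f(X+Y,X)=\sum_{\substack{r+s=k\\ r,s\ge 1}}\binom{k-2}{r-1}\,q^f_{r,s}\,X^{r-1}Y^{s-1}.$$ Then $$\frac{L_f^*(1)}{2(k-2)!}\,f(q)=\sum_{\substack{r+s=k\\ r,s\ge 2}}q^f_{r,s}\,\hat\zeta_q(r,s)-\lambda_f\,\zeta_q(k)-R_f(q),$$ where $$\lambda_f=\frac{k-1}{2}\left(\sum_{\substack{r+s=k\\ r,s\ge 3\text{ odd}}}\frac{(-1)^{\frac{s-1}{2}}}{r\,2^{r-1}}\binom{k-2}{s-1}L_f^*(s)-L_f^*(1)\right)$$ and $R_f(q)\in\mathbb{C}[[q]]$ is the $q$-series $$R_f(q)=\sum_{\substack{r+s=k\\ r,s\ge 3\text{ odd}}}c_{r,s}\left(\sum_{j=1}^{r-1}\binom{r}{j}\frac{B_j\,(k-j-1)!}{r\,2^{r-j}\,(k-2)!}\,\zeta_q(k-j)-\frac{1}{2^r}\,\zeta^{\mathbf e}_q(k-1)\right)+\sum_{\substack{r+s=k\\ r,s\ge 3\text{ odd}}}c_{r,s}\sum_{\substack{0\le j\le r-1\\ 1\le l\le r-j}}\binom{r}{j}\binom{r-j}{l}\frac{(-1)^lB_j\,(k-j-l-1)!}{r\,2^{r-j}\,(k-2)!}\,\zeta^{\mathbf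 o}_q(k-j-l),$$ with $c_{r,s}$ the coefficients of $P^{ev,0}_f(X,Y)=\sum_{r+s=k;\ r,s\ge3\text{ odd}}c_{r,s}X^{r-1}Y^{s-1}$.
   Context: $M_k$ and $S_k$ denote the spaces of modular forms and cusp forms of weight $k$ for $\mathrm{SL}_2(\mathbb{Z})$, with $q=e^{2\pi i\tau}$; $T_n$ is the $n$-th Hecke operator on $M_k$ (standard normalization, so that the eigenvalues of an eigenform with $a_1=1$ are its Fourier coefficients). For $f=\sum_{n\ge0}a_nq^n\in M_k$, the completed $L$-function is $L_f^*(s)=\int_0^\infty (f(iy)-a_0)y^{s-1}\,dy=(2\pi)^{-s}\Gamma(s)\sum_{n\ge1}a_nn^{-s}$ for $\Re(s)\gg0$, continued meromorphically to $\mathbb{C}$. The even restricted period polynomial of $f$ is $$P^{ev,0}_f(X,Y)=\sum_{\substack{r+s=k\\ r,s\ge3\text{ odd}}}(-1)^{\frac{s-1}{2}}\binom{k-2}{s-1}L_f^*(s)X^{r-1}Y^{s-1}.$$ For $k\ge1$ let $Q_k(t)\in t\mathbb{Q}[t]$ be the polynomial defined by $\frac{Q_k(t)}{(1-t)^k}=\frac{1}{(k-1)!}\sum_{d>0}d^{k-1}t^d$. For $k,r,s\ge1$ define the $q$-series in $\mathbb{Q}[[q]]$ $$\zeta_q(k)=\sum_{n>0}\frac{Q_k(q^n)}{(1-q^n)^k},\qquad \hat\zeta_q(r,s)=\sum_{0<n<m}\frac{Q_r(q^{n+m})}{(1-q^{n+m})^r}\,\frac{Q_s(q^m)}{(1-q^m)^s},$$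 $$\zeta^{\mathbf e}_q(k)=\sum_{\substack{a,d>0\\ d\text{ even}}}\frac{d^{k-1}}{(k-1)!}q^{ad},\qquad \zeta^{\mathbf o}_q(k)=\sum_{\substack{a,d>0\\ d\text{ odd}}}\frac{d^{k-1}}{(k-1)!}q^{ad}.$$ $B_j$ denotes the Bernoulli numbers with the convention $B_1=+\tfrac12$. *)

theory Defs
  imports
    "HOL-Complex_Analysis.Complex_Analysis"
    "HOL-Computational_Algebra.Computational_Algebra"
begin

section \<open>Modular forms for the full modular group\<close>

text \<open>Forms are total functions on the complex numbers; only their values on the upper half plane
  are ever used.\<close>

definition upper_half_plane :: "complex set" where
  "upper_half_plane = {\<tau>. Im \<tau> > 0}"

definition has_q_expansion :: "(complex \<Rightarrow> complex) \<Rightarrow> complex fps \<Rightarrow> bool" where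
  "has_q_expansion f F \<longleftrightarrow>
     (\<forall>\<tau>\<in>upper_half_plane. (\<lambda>n. fps_nth F n * exp (2 * of_real pi * \<i> * \<tau>) ^ n) sums f \<tau>)"

definition q_expansion :: "(complex \<Rightarrow> complex) \<Rightarrow> complex fps" where
  "q_expansion f = (THE F. has_q_expansion f F)"

definition modular_forms :: "nat \<Rightarrow> (complex \<Rightarrow> complex) set" where
  "modular_forms k = {f. f holomorphic_on upper_half_plane \<and>
     (\<forall>a b c d :: int. a * d - b * c = 1 \<longrightarrow>
        (\<forall>\<tau>\<in>upper_half_plane.
           f ((of_int a * \<tau> + of_int b) / (of_int c * \<tau> + of_int d))
             = (of_int c * \<tau> + of_int d) ^ k * f \<tau>)) \<and>
     (\<exists>F. has_q_expansion f F)}"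

definition cusp_forms :: "nat \<Rightarrow> (complex \<Rightarrow> complex) set" where
  "cusp_forms k = {f \<in> modular_forms k. fps_nth (q_expansion f) 0 = 0}"

text \<open>The representatives \<open>(a, b; 0, d)\<close> with \<open>a d = n\<close> and \<open>0 \<le> b < d\<close>; the factor
  \<open>n\<^sup>k\<^sup>-\<^sup>1\<close> is the normalization for which eigenvalues are Fourier coefficients.\<close>

definition hecke :: "nat \<Rightarrow> nat \<Rightarrow> (complex \<Rightarrow> complex) \<Rightarrow> complex \<Rightarrow> complex" where
  "hecke k n f \<tau> = of_nat n powi (int k - 1) *
     (\<Sum>d | d dvd n. \<Sum>b<d.
        f ((of_nat (n div d) * \<tau> + of_nat b) / of_nat d) / of_nat d ^ k)"


section \<open>Completed L-function and even restricted period polynomial\<close>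

text \<open>The meromorphic continuation of the Mellin integral from some right half plane.  Nicely
  meromorphic functions take the value 0 at poles and have no removable singularities, which makes
  the continuation unique as a total function.\<close>

definition completed_L :: "(complex \<Rightarrow> complex) \<Rightarrow> complex \<Rightarrow> complex" where
  "completed_L f = (THE L. L nicely_meromorphic_on UNIV \<and>
     (\<exists>\<sigma>::real. \<forall>s. Re s > \<sigma> \<longrightarrow>
        ((\<lambda>y::real. (f (\<i> * of_real y) - fps_nth (q_expansion f) 0) * of_real y powr (s - 1))
           has_integral L s) {0<..}))"

definition odd_pairs :: "nat \<Rightarrow> (nat \<times> nat) set" where
  "odd_pairs k = {(r, s). r + s = k \<and> r \<ge> 3 \<and> s \<ge> 3 \<and> odd r \<and> odd s}"

definition period_coeff :: "nat \<Rightarrow> (complex \<Rightarrow> complex) \<Rightarrow> nat \<Rightarrow> nat \<Rightarrow> complex" where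
  "period_coeff k f r s =
     (-1) ^ ((s - 1) div 2) * of_nat ((k - 2) choose (s - 1)) * completed_L f (of_nat s)"

text \<open>As a polynomial function in two complex variables.\<close>

definition period_poly_ev0 ::
    "nat \<Rightarrow> (complex \<Rightarrow> complex) \<Rightarrow> complex \<Rightarrow> complex \<Rightarrow> complex" where
  "period_poly_ev0 k f X Y =
     (\<Sum>(r, s)\<in>odd_pairs k. period_coeff k f r s * X ^ (r - 1) * Y ^ (s - 1))"


section \<open>The q-series\<close>

definition Q_poly :: "nat \<Rightarrow> rat poly" where
  "Q_poly k = (THE p. poly p 0 = 0 \<and>
     fps_of_poly p / (1 - fps_X) ^ k =
       fps_const (1 / fact (k - 1)) * Abs_fps (\<lambda>d. if d > 0 then of_nat d ^ (k - 1) else 0))"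

text \<open>\<open>Q\<^sub>k(q\<^sup>n) / (1 - q\<^sup>n)\<^sup>k\<close>\<close>

definition Q_term :: "nat \<Rightarrow> nat \<Rightarrow> rat fps" where
  "Q_term k n = fps_compose (fps_of_poly (Q_poly k)) (fps_X ^ n) / (1 - fps_X ^ n) ^ k"

text \<open>All infinite sums below are taken in the \<open>q\<close>-adic topology on formal power series.\<close>

definition zeta_q :: "nat \<Rightarrow> rat fps" where
  "zeta_q k = (\<Sum>\<^sub>\<infinity>n\<in>{0<..}. Q_term k n)"

definition zeta_q_hat :: "nat \<Rightarrow> nat \<Rightarrow> rat fps" where
  "zeta_q_hat r s = (\<Sum>\<^sub>\<infinity>(n, m)\<in>{(n, m). 0 < n \<and> n < m}. Q_term r (n + m) * Q_term s m)"

definition zeta_q_even :: "nat \<Rightarrow> rat fps" where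
  "zeta_q_even k = (\<Sum>\<^sub>\<infinity>(a, d)\<in>{(a, d). 0 < a \<and> 0 < d \<and> even d}.
     fps_const (of_nat d ^ (k - 1) / fact (k - 1)) * fps_X ^ (a * d))"

definition zeta_q_odd :: "nat \<Rightarrow> rat fps" where
  "zeta_q_odd k = (\<Sum>\<^sub>\<infinity>(a, d)\<in>{(a, d). 0 < a \<and> 0 < d \<and> odd d}.
     fps_const (of_nat d ^ (k - 1) / fact (k - 1)) * fps_X ^ (a * d))"

definition fps_of_rat :: "rat fps \<Rightarrow> complex fps" where
  "fps_of_rat F = Abs_fps (\<lambda>n. of_rat (fps_nth F n))"

text \<open>The generating function \<open>t / (1 - e\<^sup>-\<^sup>t)\<close> corresponds to the convention \<open>B\<^sub>1 = +1/2\<close>.\<close>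

definition bernoulli :: "nat \<Rightarrow> rat" where
  "bernoulli j = fact j * fps_nth (fps_X / (1 - fps_exp (-1))) j"


section \<open>The correction terms\<close>

definition lambda_f :: "nat \<Rightarrow> (complex \<Rightarrow> complex) \<Rightarrow> complex" where
  "lambda_f k f = (of_nat k - 1) / 2 *
     ((\<Sum>(r, s)\<in>odd_pairs k.
         (-1) ^ ((s - 1) div 2) / (of_nat r * 2 ^ (r - 1)) * of_nat ((k - 2) choose (s - 1))
           * completed_L f (of_nat s))
      - completed_L f 1)"

definition R_f :: "nat \<Rightarrow> (complex \<Rightarrow> complex) \<Rightarrow> complex fps" where
  "R_f k f =
     (\<Sum>(r, s)\<in>odd_pairs k. fps_const (period_coeff k f r s) *
        ((\<Sum>j=1..r-1.
            fps_const (of_nat (r choose j) * of_rat (bernoulli j) * fact (k - j - 1)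
                       / (of_nat r * 2 ^ (r - j) * fact (k - 2)))
            * fps_of_rat (zeta_q (k - j)))
         - fps_const (1 / 2 ^ r) * fps_of_rat (zeta_q_even (k - 1))))
   + (\<Sum>(r, s)\<in>odd_pairs k. fps_const (period_coeff k f r s) *
        (\<Sum>(j, l)\<in>{(j, l). j \<le> r - 1 \<and> 1 \<le> l \<and> l \<le> r - j}.
            fps_const (of_nat (r choose j) * of_nat ((r - j) choose l)
                       * (-1) ^ l * of_rat (bernoulli j) * fact (k - j - l - 1)
                       / (of_nat r * 2 ^ (r - j) * fact (k - 2)))
            * fps_of_rat (zeta_q_odd (k - j - l))))"

end

theory Submission
  imports Defs "HOL-Real_Asymp.Real_Asymp"
begin

text \<open>
  Write \<open>w = k - 2\<close>.  The periods \<open>\<Phi>(p, q) = \<integral> f(z) (q z - p)\<^sup>w dz\<close> from \<open>p/q\<close> to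
  \<open>\<i>\<infinity>\<close> satisfy \<open>\<Phi>(p + q, q) = \<Phi>(p, q)\<close> and \<open>\<Phi>(p, q) - \<Phi>(-q, p) = R(p, q)\<close>, where \<open>R\<close> is
  the period polynomial, and the Hecke eigenvalue equation becomes
  \<open>\<Sum>\<^sub>D\<^sub>|\<^sub>N \<Sum>\<^sub>b\<^sub><\<^sub>D \<Phi>(b, D) = a\<^sub>N \<Phi>(0, 1)\<close>.  Removing the multiple \<open>R(0, 1) (q\<^sup>w - p\<^sup>w)\<close> of the
  Eisenstein part and taking the even part leaves a function \<open>h\<close> with \<open>h(0, q) = 0\<close>.  For such \<open>h\<close> a
  Euclidean division inside the sum over \<open>m D + n d = N\<close>, \<open>m > n > 0\<close>, \<open>D > d > 0\<close>, turns
  \<open>\<Sum>\<^sub>D\<^sub>|\<^sub>N \<Sum>\<^sub>b\<^sub><\<^sub>D h(b, D)\<close> into the sum of \<open>h(d, D) - h(D, d)\<close>, that is of the even restricted period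
  polynomial, over these solutions, plus a boundary sum over \<open>b \<le> D/2\<close>: this is Manin's formula for
  the coefficients of an eigenform.  The coefficient of \<open>q\<^sup>N\<close> in the double series runs over exactly
  the same solutions, and Faulhaber's formula evaluates the boundary sum, which yields
  \<open>\<lambda>\<^sub>f\<close> and \<open>R\<^sub>f\<close>.
\<close>

section \<open>Sums over solutions of m D + n d = N\<close>

text \<open>The Eisenstein correction is forced twice. It makes h(0, q) vanish, so that the
  Euclidean step leaves nothing at multiples of the modulus. It also removes the two extreme
  monomials of the even period polynomial, which the functional equation ties together, and so
  leaves exactly P^{ev,0}. Its own Hecke sum is a divisor sum, the source of the L(1) part of
  \<open>lambda_f\<close>. Passing to the even part makes h invariant under b -> D - b, so sums over
  residues fold to b < D/2. Faulhaber at D/2 or (D - 1)/2 then produces the powers of 2 and the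
  split by parity of D in \<open>R_f\<close>. No path integral is ever taken up to a cusp. An
  explicit primitive of f(z) (u z + v)^w vanishing at \<i>\<infinity> is available, periods are its
  one-sided limits, and the transformation and Hecke relations follow because a function with zero
  derivative on the half plane is constant. The L-values are matched with these limits through
  compact pieces of the imaginary axis.\<close>

definition manin_quads :: "nat \<Rightarrow> (nat \<times> nat \<times> nat \<times> nat) set" where
  "manin_quads N = {(m, n, D, d). 0 < n \<and> n < m \<and> 0 < d \<and> d < D \<and> m * D + n * d = N}"

lemma finite_manin_quads: "finite (manin_quads N)"
proof (rule finite_subset)
  show "manin_quads N \<subseteq> {..N} \<times> {..N} \<times> {..N} \<times> {..N}"
  proof
    fix x assume "x \<in> manin_quads N"
    then obtain m n D d where x: "x = (m, n, D, d)" and *: "0 < n" "n < m" "0 < d" "d < D" "m * D + n * d = N"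
      by (auto simp: manin_quads_def)
    have "m * 1 \<le> m * D" "1 * D \<le> m * D"
      using * by (intro mult_le_mono; simp)+
    hence "m \<le> N" "D \<le> N" using * by linarith+
    with * show "x \<in> {..N} \<times> {..N} \<times> {..N} \<times> {..N}" by (simp add: x)
  qed
qed simp

lemma periodic_mod:
  fixes h :: "nat \<Rightarrow> nat \<Rightarrow> 'a"
  assumes "\<And>p q. h (p + q) q = h p q"
  shows "h (p mod q) q = h p q"
proof -
  have "h (r + j * q) q = h r q" for r j
    by (induction j) (use assms[of "r + _ * q" q] in \<open>simp_all add: add_ac\<close>)
  from this[of "p mod q" "p div q"] show ?thesis by simp
qed

text \<open>Division with remainder cancels most terms. For D = a d + e one has m D + n d = (m a +
  n) d + m e and h D d = h e d, so each h D d with d not dividing D occurs as a positive term of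
  another quadruple. The positive terms left over are those with n dividing m.\<close>

lemma manin_sum_swap:
  fixes h :: "nat \<Rightarrow> nat \<Rightarrow> 'a::ab_group_add"
  assumes h0: "\<And>q. h 0 q = 0"
    and per: "\<And>p q. h (p + q) q = h p q"
    and N: "N > 0"
  shows "(\<Sum>(m, n, D, d)\<in>manin_quads N. h d D - h D d) =
           (\<Sum>D | D dvd N. \<Sum>b | 0 < b \<and> 2 * b < D. h D b)"
proof -
  let ?A = "manin_quads N"
  have h_dvd: "h p q = 0" if "q dvd p" for p q
    using periodic_mod[of h p q, OF per] h0 that by simp
  \<comment> \<open>\<open>B\<close> consists of the quadruples whose second entry does not divide
    the first. The division step maps \<open>A2\<close> bijectively onto it: M = m a + n and D = a d
    + e share the quotient a, which makes the step invertible.\<close>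
  define B where "B = {(M, m, d, e). 0 < m \<and> m < M \<and> \<not> m dvd M \<and> 0 < e \<and> e < d \<and> M * d + m * e = N}"
  define A2 where "A2 = {(m, n, D, d). (m, n, D, d) \<in> ?A \<and> \<not> d dvd D}"
  have fA: "finite ?A" by (rule finite_manin_quads)
  have "(\<Sum>(m, n, D, d)\<in>?A. h D d) = (\<Sum>(m, n, D, d)\<in>A2. h D d)"
  proof (rule sum.mono_neutral_right[OF fA])
    show "\<forall>x\<in>?A - A2. (case x of (m, n, D, d) \<Rightarrow> h D d) = 0"
      by (auto simp: A2_def h_dvd)
  qed (auto simp: A2_def)
  also have "\<dots> = (\<Sum>(M, m, d, e)\<in>B. h e d)"
  proof (rule sum.reindex_bij_witness[where
        i = "\<lambda>(M, m, d, e). (m, M mod m, (M div m) * d + e, d)" and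
        j = "\<lambda>(m, n, D, d). (m * (D div d) + n, m, d, D mod d)"], goal_cases)
    case (1 x)
    then obtain m n D d where x: "x = (m, n, D, d)" by (cases x)
    show ?case using 1 by (auto simp: x A2_def manin_quads_def)
  next
    case (2 x)
    then obtain m n D d where x: "x = (m, n, D, d)" by (cases x)
    have *: "0 < n" "n < m" "0 < d" "d < D" "m * D + n * d = N" "\<not> d dvd D"
      using 2 by (auto simp: x A2_def manin_quads_def)
    have "(m * (D div d) + n) * d + m * (D mod d) = m * (D div d * d + D mod d) + n * d"
      by (simp only: algebra_simps)
    hence "(m * (D div d) + n) * d + m * (D mod d) = N" using * by simp
    moreover have "D div d \<ge> 1" using * by (simp add: div_greater_zero_iff Suc_le_eq)
    hence "m * 1 \<le> m * (D div d)" by (intro mult_le_mono) auto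
    hence "m < m * (D div d) + n" using * by linarith
    moreover have "\<not> m dvd m * (D div d) + n" using * by (simp add: dvd_add_right_iff nat_dvd_not_less)
    moreover have "0 < D mod d" using * by (simp add: dvd_eq_mod_eq_0)
    ultimately show ?case using * by (simp add: x B_def)
  next
    case (3 x)
    then obtain M m d e where x: "x = (M, m, d, e)" by (cases x)
    show ?case using 3 by (auto simp: x B_def)
  next
    case (4 x)
    then obtain M m d e where x: "x = (M, m, d, e)" by (cases x)
    have *: "0 < m" "m < M" "\<not> m dvd M" "0 < e" "e < d" "M * d + m * e = N"
      using 4 by (auto simp: x B_def)
    have "m * (M div m * d + e) + M mod m * d = (m * (M div m) + M mod m) * d + m * e"
      by (simp only: algebra_simps)
    hence "m * (M div m * d + e) + M mod m * d = N" using * by simp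
    moreover have "M div m \<ge> 1" using * by (simp add: div_greater_zero_iff Suc_le_eq)
    hence "1 * d \<le> (M div m) * d" by (intro mult_le_mono) auto
    hence "d < M div m * d + e" using * by linarith
    moreover have "0 < M mod m" using * by (simp add: dvd_eq_mod_eq_0)
    moreover have "\<not> d dvd M div m * d + e" using * by (simp add: dvd_add_right_iff nat_dvd_not_less)
    ultimately show ?case using * by (simp add: x A2_def manin_quads_def)
  next
    case (5 x)
    then obtain m n D d where x: "x = (m, n, D, d)" by (cases x)
    show ?case using periodic_mod[of h, OF per] by (simp add: x)
  qed
  finally have A2: "(\<Sum>(m, n, D, d)\<in>?A. h D d) = (\<Sum>(M, m, d, e)\<in>B. h e d)" .
  define C where "C = {(m, n, D, d). (m, n, D, d) \<in> ?A \<and> n dvd m}"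
  have AB: "?A = B \<union> C" "B \<inter> C = {}"
    by (auto simp: B_def C_def manin_quads_def)
  have fBC: "finite B" "finite C" using fA AB(1) by auto
  have "(\<Sum>(m, n, D, d)\<in>?A. h d D - h D d) = (\<Sum>(m, n, D, d)\<in>?A. h d D) - (\<Sum>(m, n, D, d)\<in>?A. h D d)"
    by (simp add: sum_subtractf case_prod_unfold)
  also have "(\<Sum>(m, n, D, d)\<in>?A. h d D) = (\<Sum>(m, n, D, d)\<in>B. h d D) + (\<Sum>(m, n, D, d)\<in>C. h d D)"
    using AB fBC by (simp add: sum.union_disjoint)
  finally have "(\<Sum>(m, n, D, d)\<in>?A. h d D - h D d) = (\<Sum>(m, n, D, d)\<in>C. h d D)"
    by (simp add: A2)
  \<comment> \<open>Here m = n j with j >= 2, as n < m. Hence N = n (j D + d), the divisor j D + d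
    of N exceeds 2 D, and h d D = h (j D + d) D by periodicity. Since 0 < d < D, the old D does not
    divide the new one.\<close>
  also have "\<dots> = (\<Sum>(D, b)\<in>{(D, b). D dvd N \<and> 0 < b \<and> 2 * b < D \<and> \<not> b dvd D}. h D b)"
  proof (rule sum.reindex_bij_witness[where
        i = "\<lambda>(D, b). (D div b * (N div D), N div D, b, D mod b)" and
        j = "\<lambda>(m, n, D, d). (m div n * D + d, D)"], goal_cases)
    case (1 x)
    then obtain m n D d where x: "x = (m, n, D, d)" by (cases x)
    obtain j where j: "m = n * j" using 1 by (auto simp: x C_def)
    have *: "0 < n" "n < m" "0 < d" "d < D" "m * D + n * d = N"
      using 1 by (auto simp: x C_def manin_quads_def)
    have "N = n * (j * D + d)" using * j by (simp add: algebra_simps)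
    moreover have "j * D + d > 0" using * by simp
    ultimately have "N div (j * D + d) = n" by simp
    thus ?case using * j by (simp add: x)
  next
    case (2 x)
    then obtain m n D d where x: "x = (m, n, D, d)" by (cases x)
    obtain j where j: "m = n * j" using 2 by (auto simp: x C_def)
    have *: "0 < n" "n < m" "0 < d" "d < D" "m * D + n * d = N"
      using 2 by (auto simp: x C_def manin_quads_def)
    have "N = n * (j * D + d)" using * j by (simp add: algebra_simps)
    moreover have "j \<noteq> 0" "j \<noteq> 1" using * j by auto
    hence "2 \<le> j" by simp
    hence "2 * D \<le> j * D" by (intro mult_le_mono) auto
    hence "2 * D < j * D + d" using * by linarith
    moreover have "\<not> D dvd j * D + d" using * by (simp add: dvd_add_right_iff nat_dvd_not_less)
    ultimately show ?case using * j by (simp add: x)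
  next
    case (3 x)
    then obtain D b where x: "x = (D, b)" by (cases x)
    have *: "D dvd N" "0 < b" "2 * b < D" "\<not> b dvd D" using 3 by (auto simp: x)
    moreover have "N div D > 0" using * N by (simp add: div_greater_zero_iff dvd_imp_le)
    ultimately show ?case by (simp add: x)
  next
    case (4 x)
    then obtain D b where x: "x = (D, b)" by (cases x)
    have *: "D dvd N" "0 < b" "2 * b < D" "\<not> b dvd D" using 4 by (auto simp: x)
    have n: "N div D > 0" using * N by (simp add: div_greater_zero_iff dvd_imp_le)
    have "D div b \<ge> 2" using * by (simp add: less_eq_div_iff_mult_less_eq)
    hence "2 * (N div D) \<le> D div b * (N div D)" by (intro mult_le_mono) auto
    hence "N div D < D div b * (N div D)" using n by linarith
    moreover have "D div b * (N div D) * b + N div D * (D mod b) = N div D * (D div b * b + D mod b)"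
      by (simp only: algebra_simps)
    hence "D div b * (N div D) * b + N div D * (D mod b) = N" using * by simp
    moreover have "0 < D mod b" using * by (simp add: dvd_eq_mod_eq_0)
    ultimately show ?case using * n by (simp add: x C_def manin_quads_def)
  next
    case (5 x)
    then obtain m n D d where x: "x = (m, n, D, d)" by (cases x)
    have "d < D" using 5 by (auto simp: x C_def manin_quads_def)
    hence "(m div n * D + d) mod D = d" by simp
    thus ?case using periodic_mod[of h, OF per, of "m div n * D + d" D] by (simp add: x)
  qed
  \<comment> \<open>Pairs with b dividing D may be added because h D b = 0 there.\<close>
  also have "\<dots> = (\<Sum>(D, b)\<in>(SIGMA D:{D. D dvd N}. {b. 0 < b \<and> 2 * b < D}). h D b)"
  proof (rule sum.mono_neutral_left)
    have "{b. 0 < b \<and> 2 * b < D} \<subseteq> {..D}" for D :: nat by auto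
    thus "finite (SIGMA D:{D. D dvd N}. {b. 0 < b \<and> 2 * b < D})"
      using N by (intro finite_SigmaI) (auto intro: finite_subset)
  next
    show "\<forall>x\<in>(SIGMA D:{D. D dvd N}. {b. 0 < b \<and> 2 * b < D})
             - {(D, b). D dvd N \<and> 0 < b \<and> 2 * b < D \<and> \<not> b dvd D}. (case x of (D, b) \<Rightarrow> h D b) = 0"
      by (auto simp: h_dvd)
  qed auto
  also have "\<dots> = (\<Sum>D | D dvd N. \<Sum>b | 0 < b \<and> 2 * b < D. h D b)"
  proof -
    have "{b. 0 < b \<and> 2 * b < D} \<subseteq> {..D}" for D :: nat by auto
    hence "finite {b. 0 < b \<and> 2 * b < D}" for D :: nat by (rule finite_subset) simp
    thus ?thesis using N by (subst sum.Sigma) auto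
  qed
  finally show ?thesis .
qed

lemma sum_reflected_halves:
  fixes g :: "nat \<Rightarrow> 'a::comm_ring_1"
  assumes rfl: "\<And>b. b \<le> D \<Longrightarrow> g (D - b) = g b" and g0: "g 0 = 0" and D: "D > 0"
  shows "(\<Sum>b<D. g b) = 2 * (\<Sum>b | 0 < b \<and> 2 * b < D. g b) + (if even D then g (D div 2) else 0)"
proof -
  let ?L = "{b. 0 < b \<and> 2 * b < D}" and ?U = "{b. b < D \<and> D < 2 * b}"
  let ?M = "{b. 2 * b = D}"
  have fin: "finite ?L" "finite ?U" by (rule finite_subset[of _ "{..D}"]; auto)+
  have M: "?M = (if even D then {D div 2} else {})" by auto
  have "{..<D} = {0} \<union> (?L \<union> (?U \<union> ?M))" using D by auto
  hence "(\<Sum>b<D. g b) = (\<Sum>b\<in>{0} \<union> (?L \<union> (?U \<union> ?M)). g b)" by simp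
  also have "\<dots> = (\<Sum>b\<in>{0}. g b) + (\<Sum>b\<in>?L \<union> (?U \<union> ?M). g b)"
    using fin D by (intro sum.union_disjoint) (auto simp: M)
  also have "(\<Sum>b\<in>?L \<union> (?U \<union> ?M). g b) = (\<Sum>b\<in>?L. g b) + (\<Sum>b\<in>?U \<union> ?M. g b)"
    using fin by (intro sum.union_disjoint) (auto simp: M)
  also have "(\<Sum>b\<in>?U \<union> ?M. g b) = (\<Sum>b\<in>?U. g b) + (\<Sum>b\<in>?M. g b)"
    using fin by (intro sum.union_disjoint) (auto simp: M)
  also have "(\<Sum>b\<in>?U. g b) = (\<Sum>b\<in>?L. g b)"
    by (rule sum.reindex_bij_witness[where i = "\<lambda>b. D - b" and j = "\<lambda>b. D - b"]) (auto simp: rfl)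
  finally show ?thesis using g0 by (simp add: M)
qed

text \<open>Folding by b -> D - b leaves b < D/2, where h b D = h D b + S b D. The terms h D b are
  those that \<open>manin_sum_swap\<close> trades for the sum over quadruples. The midpoint is its
  own mirror image and therefore occurs once, not twice.\<close>

theorem manin_sum:
  fixes h S :: "nat \<Rightarrow> nat \<Rightarrow> 'a::comm_ring_1"
  assumes h0: "\<And>q. h 0 q = 0"
    and per: "\<And>p q. h (p + q) q = h p q"
    and rfl: "\<And>p q. p \<le> q \<Longrightarrow> h (q - p) q = h p q"
    and rel: "\<And>p q. p > 0 \<Longrightarrow> q > 0 \<Longrightarrow> h p q - h q p = S p q"
    and N: "N > 0"
  shows "(\<Sum>D | D dvd N. \<Sum>b<D. h b D) =
           2 * (\<Sum>(m, n, D, d)\<in>manin_quads N. S d D) +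
           (\<Sum>D | D dvd N. 2 * (\<Sum>b | 0 < b \<and> 2 * b < D. S b D) +
                            (if even D then S (D div 2) D else 0))"
proof -
  have "(\<Sum>b<D. h b D) = 2 * (\<Sum>b | 0 < b \<and> 2 * b < D. h D b)
          + (2 * (\<Sum>b | 0 < b \<and> 2 * b < D. S b D) + (if even D then S (D div 2) D else 0))"
    if D: "D dvd N" for D
  proof -
    have "D > 0" using D N dvd_pos_nat by blast
    have "(\<Sum>b<D. h b D) = 2 * (\<Sum>b | 0 < b \<and> 2 * b < D. h b D) + (if even D then h (D div 2) D else 0)"
      by (rule sum_reflected_halves[where g = "\<lambda>b. h b D", OF rfl h0 \<open>D > 0\<close>])
    also have "(\<Sum>b | 0 < b \<and> 2 * b < D. h b D) = (\<Sum>b | 0 < b \<and> 2 * b < D. h D b + S b D)"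
      by (intro sum.cong refl) (use N D dvd_pos_nat in \<open>simp add: rel[symmetric]\<close>)
    also have "(if even D then h (D div 2) D else 0) = (if even D then S (D div 2) D else 0)"
    proof (cases "even D")
      case True
      then obtain e where e: "D = 2 * e" by auto
      \<comment> \<open>D = 2 e is a multiple of e, so only S contributes at the midpoint.\<close>
      have "h D e = 0" using periodic_mod[of h, OF per, of D e] h0 e by simp
      thus ?thesis using rel[of e D, symmetric] e \<open>D > 0\<close> by simp
    qed auto
    finally show ?thesis by (simp add: sum.distrib algebra_simps)
  qed
  hence "(\<Sum>D | D dvd N. \<Sum>b<D. h b D) =
      2 * (\<Sum>D | D dvd N. \<Sum>b | 0 < b \<and> 2 * b < D. h D b) +
      (\<Sum>D | D dvd N. 2 * (\<Sum>b | 0 < b \<and> 2 * b < D. S b D) + (if even D then S (D div 2) D else 0))"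
    by (simp add: sum.distrib sum_distrib_left)
  also have "(\<Sum>D | D dvd N. \<Sum>b | 0 < b \<and> 2 * b < D. h D b)
               = (\<Sum>(m, n, D, d)\<in>manin_quads N. h d D - h D d)"
    by (rule manin_sum_swap[OF h0 per N, symmetric])
  also have "\<dots> = (\<Sum>(m, n, D, d)\<in>manin_quads N. S d D)"
    by (intro sum.cong refl) (auto simp: manin_quads_def rel)
  finally show ?thesis .
qed

section \<open>Coefficients of the q-series\<close>

text \<open>Convergence of formal power series means that each coefficient becomes stationary along
  finite subsets, which local finiteness ensures. \<open>B\<close> may be any finite set containing
  the support of the n-th coefficient, so each application can use its natural index set.\<close>

lemma fps_infsum_nth:
  fixes f :: "'i \<Rightarrow> 'a::ab_group_add fps"
  assumes "\<And>n. finite {x\<in>A. fps_nth (f x) n \<noteq> 0}"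
    and "finite B" "B \<subseteq> A" "\<And>x. x \<in> A \<Longrightarrow> x \<notin> B \<Longrightarrow> fps_nth (f x) n = 0"
  shows "fps_nth (\<Sum>\<^sub>\<infinity>x\<in>A. f x) n = (\<Sum>x\<in>B. fps_nth (f x) n)"
proof -
  define S where "S n = {x\<in>A. fps_nth (f x) n \<noteq> 0}" for n
  define G where "G = Abs_fps (\<lambda>n. \<Sum>x\<in>S n. fps_nth (f x) n)"
  have "(f has_sum G) A"
    unfolding has_sum_def
  proof (rule tendsto_fpsI)
    fix m
    show "\<forall>\<^sub>F X in finite_subsets_at_top A. fps_nth (sum f X) m = fps_nth G m"
      unfolding eventually_finite_subsets_at_top
    proof (intro exI[of _ "S m"] conjI allI impI)
      show "finite (S m)" "S m \<subseteq> A" using assms(1) by (auto simp: S_def)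
      fix Y assume Y: "finite Y \<and> S m \<subseteq> Y \<and> Y \<subseteq> A"
      have "(\<Sum>x\<in>Y. fps_nth (f x) m) = (\<Sum>x\<in>S m. fps_nth (f x) m)"
        using Y by (intro sum.mono_neutral_right) (auto simp: S_def)
      thus "fps_nth (sum f Y) m = fps_nth G m" by (simp add: G_def fps_sum_nth)
    qed
  qed
  hence "infsum f A = G" by (rule infsumI)
  moreover have "(\<Sum>x\<in>S n. fps_nth (f x) n) = (\<Sum>x\<in>B. fps_nth (f x) n)"
    using assms by (intro sum.mono_neutral_left) (auto simp: S_def)
  ultimately show ?thesis by (simp add: G_def)
qed

definition divisor_power_fps :: "nat \<Rightarrow> rat fps" where
  "divisor_power_fps k = Abs_fps (\<lambda>d. if d > 0 then of_nat d ^ (k - 1) else 0)"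

text \<open>The operator X d/dX raises the exponent of d by one, and the product rule turns this
  into the Eulerian recurrence p -> X (1 - X) p' + k X p for the numerators. The polynomial found
  here is the existence half of the definite description in \<open>Q_poly\<close>.\<close>

lemma divisor_power_fps_poly:
  assumes "k \<ge> 1"
  shows "\<exists>p. poly p 0 = 0 \<and> fps_of_poly p = (1 - fps_X) ^ k * divisor_power_fps k"
  using assms
proof (induction k rule: dec_induct)
  case base
  have "(1 - fps_X) ^ 1 * divisor_power_fps 1 = fps_X"
    by (rule fps_ext) (auto simp: divisor_power_fps_def ring_distribs)
  thus ?case by (intro exI[of _ "[:0, 1:]"]) simp
next
  case (step k)
  then obtain p where p: "poly p 0 = 0" "fps_of_poly p = (1 - fps_X) ^ k * divisor_power_fps k"
    by blast
  obtain j where j: "k = Suc j" using step.hyps by (cases k) auto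
  have G: "divisor_power_fps (Suc k) = fps_X * fps_deriv (divisor_power_fps k)"
  proof (rule fps_ext)
    fix n show "fps_nth (divisor_power_fps (Suc k)) n = fps_nth (fps_X * fps_deriv (divisor_power_fps k)) n"
      by (cases n) (auto simp: divisor_power_fps_def j)
  qed
  have d: "fps_deriv (fps_of_poly p) = (1 - fps_X) ^ k * fps_deriv (divisor_power_fps k)
             - of_nat k * (1 - fps_X) ^ j * divisor_power_fps k"
  proof -
    have "fps_deriv ((1 - fps_X :: rat fps) ^ Suc j) = - (of_nat (Suc j) * (1 - fps_X) ^ j)"
      by (subst fps_deriv_power) (simp del: of_nat_Suc power_Suc add: fps_of_nat flip: fps_const_neg)
    thus ?thesis unfolding p(2) j fps_deriv_mult by (simp del: of_nat_Suc power_Suc add: algebra_simps)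
  qed
  have "(1 - fps_X) ^ Suc k * divisor_power_fps (Suc k) =
          fps_X * (1 - fps_X) * fps_deriv (fps_of_poly p) + of_nat k * fps_X * fps_of_poly p"
    unfolding d G unfolding p(2) j by (simp add: algebra_simps del: of_nat_Suc)
  also have "\<dots> = fps_of_poly ([:0, 1:] * (1 - [:0, 1:]) * pderiv p + of_nat k * [:0, 1:] * p)"
    by (simp only: fps_of_poly_add fps_of_poly_mult fps_of_poly_diff fps_of_poly_pderiv
          fps_of_poly_fps_X fps_of_poly_1 of_nat_poly fps_of_poly_const fps_of_nat)
  finally show ?case
    by (intro exI[of _ "[:0, 1:] * (1 - [:0, 1:]) * pderiv p + of_nat k * [:0, 1:] * p"]) auto
qed

lemma fps_divide_eq_iff_unit:
  fixes p u g :: "'a::field fps"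
  assumes "fps_nth u 0 \<noteq> 0"
  shows "p / u = g \<longleftrightarrow> p = u * g"
proof
  assume "p / u = g"
  hence "u * g = p * (inverse u * u)" using assms by (auto simp: fps_divide_unit)
  thus "p = u * g" using inverse_mult_eq_1[OF assms] by simp
next
  assume "p = u * g"
  moreover have "u \<noteq> 0" using assms by auto
  ultimately show "p / u = g" by simp
qed

lemma Q_poly_eq:
  assumes k: "k \<ge> 1"
  shows "fps_of_poly (Q_poly k) = (1 - fps_X) ^ k * (fps_const (1 / fact (k - 1)) * divisor_power_fps k)"
proof -
  let ?G = "fps_const (1 / fact (k - 1)) * divisor_power_fps k :: rat fps"
  have unit: "fps_nth ((1 - fps_X :: rat fps) ^ k) 0 \<noteq> 0" by (simp add: fps_power_zeroth)
  have iff: "fps_of_poly p / (1 - fps_X) ^ k = ?G \<longleftrightarrow> fps_of_poly p = (1 - fps_X) ^ k * ?G" for p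
    by (rule fps_divide_eq_iff_unit[OF unit])
  obtain p where p: "poly p 0 = 0" "fps_of_poly p = (1 - fps_X) ^ k * divisor_power_fps k"
    using divisor_power_fps_poly[OF k] by blast
  let ?P = "\<lambda>p. poly p 0 = 0 \<and> fps_of_poly p / (1 - fps_X) ^ k = ?G"
  have "?P (smult (1 / fact (k - 1)) p)"
    unfolding iff using p by (simp add: fps_of_poly_smult)
  moreover have "p1 = p2" if "?P p1" "?P p2" for p1 p2
    using that unfolding iff by (metis fps_of_poly_eq_iff)
  ultimately have "\<exists>!p. ?P p" by blast
  hence "?P (THE p. ?P p)" by (rule theI')
  moreover have "Q_poly k = (THE p. ?P p)"
    by (simp add: Q_poly_def divisor_power_fps_def)
  ultimately show ?thesis unfolding iff by simp
qed

text \<open>Substituting X^n for X is multiplicative, so the denominator (1 - X^n)^k cancels against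
  the factor from \<open>Q_poly_eq\<close>, and the coefficients d^(k-1) move to the exponents n
  d.\<close>

lemma Q_term_nth:
  assumes k: "k \<ge> 1" and n: "n > 0"
  shows "fps_nth (Q_term k n) m = (if m > 0 \<and> n dvd m then of_nat (m div n) ^ (k - 1) / fact (k - 1) else 0)"
proof -
  have X: "fps_nth (fps_X ^ n :: rat fps) 0 = 0" using n by simp
  have "fps_nth ((1 - fps_X ^ n :: rat fps) ^ k) 0 \<noteq> 0" using n by (simp add: fps_power_zeroth zero_power)
  hence nz: "(1 - fps_X ^ n :: rat fps) ^ k \<noteq> 0" by (metis fps_zero_nth)
  have "(1 - fps_X) ^ k oo fps_X ^ n = (1 - fps_X ^ n :: rat fps) ^ k"
    using X by (simp add: fps_compose_power[symmetric] fps_compose_sub_distrib)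
  hence "Q_term k n = fps_const (1 / fact (k - 1)) * (divisor_power_fps k oo fps_X ^ n)"
    using nz by (simp add: Q_term_def Q_poly_eq[OF k] fps_compose_mult_distrib[OF X])
  thus ?thesis using n
    by (auto simp: fps_nth_compose_X_power divisor_power_fps_def div_greater_zero_iff dvd_imp_le)
qed

lemma zeta_q_nth:
  assumes k: "k \<ge> 1"
  shows "fps_nth (zeta_q k) N = (if N > 0 then (\<Sum>d | d dvd N. of_nat d ^ (k - 1) / fact (k - 1)) else 0)"
proof -
  have fin: "finite {n \<in> {0<..}. fps_nth (Q_term k n) m \<noteq> 0}" for m
    by (rule finite_subset[of _ "{..m}"]) (auto simp: Q_term_nth[OF k] dest: dvd_imp_le split: if_splits)
  show ?thesis
  proof (cases "N > 0")
    case N: True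
    have "fps_nth (zeta_q k) N = (\<Sum>n | n dvd N. fps_nth (Q_term k n) N)"
      unfolding zeta_q_def
      by (rule fps_infsum_nth[OF fin]) (use N in \<open>auto simp: Q_term_nth[OF k] dvd_pos_nat\<close>)
    also have "\<dots> = (\<Sum>n | n dvd N. of_nat (N div n) ^ (k - 1) / fact (k - 1))"
      by (intro sum.cong refl) (use N in \<open>auto simp: Q_term_nth[OF k] dvd_pos_nat\<close>)
    also have "\<dots> = (\<Sum>d | d dvd N. of_nat d ^ (k - 1) / fact (k - 1))"
      by (rule sum.reindex_bij_witness[where i = "\<lambda>d. N div d" and j = "\<lambda>d. N div d"])
         (use N in auto)
    finally show ?thesis using N by simp
  next
    case False
    have "fps_nth (zeta_q k) 0 = (\<Sum>n\<in>{}. fps_nth (Q_term k n) 0)"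
      unfolding zeta_q_def by (rule fps_infsum_nth[OF fin]) (auto simp: Q_term_nth[OF k])
    thus ?thesis using False by simp
  qed
qed

lemma fps_infsum_divisor_nth:
  fixes c :: "nat \<Rightarrow> rat"
  shows "fps_nth (\<Sum>\<^sub>\<infinity>(a, d)\<in>{(a, d). 0 < a \<and> 0 < d \<and> P d}. fps_const (c d) * fps_X ^ (a * d)) N =
           (if N > 0 then (\<Sum>d | d dvd N \<and> P d. c d) else 0)"
proof -
  let ?A = "{(a, d). 0 < a \<and> 0 < d \<and> P d}"
  let ?f = "\<lambda>(a, d). fps_const (c d) * fps_X ^ (a * d)"
  define B where "B m = {(a, d). 0 < a \<and> 0 < d \<and> P d \<and> a * d = m}" for m
  have fB: "finite (B m)" for m
  proof (rule finite_subset)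
    show "B m \<subseteq> {..m} \<times> {..m}" by (auto simp: B_def)
  qed simp
  have f: "fps_nth (?f x) m = (if m = fst x * snd x then c (snd x) else 0)" for x m
    by (cases x) auto
  have fin: "finite {x \<in> ?A. fps_nth (?f x) m \<noteq> 0}" for m
    by (rule finite_subset[OF _ fB[of m]]) (auto simp: f B_def split: if_splits)
  have "fps_nth (\<Sum>\<^sub>\<infinity>x\<in>?A. ?f x) N = (\<Sum>x\<in>B N. fps_nth (?f x) N)"
    by (rule fps_infsum_nth[OF fin fB]) (auto simp: f B_def)
  also have "\<dots> = (\<Sum>x\<in>B N. c (snd x))"
    by (intro sum.cong refl) (auto simp: B_def)
  also have "\<dots> = (if N > 0 then (\<Sum>d | d dvd N \<and> P d. c d) else 0)"
  proof (cases "N > 0")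
    case True
    have "(\<Sum>x\<in>B N. c (snd x)) = (\<Sum>d | d dvd N \<and> P d. c d)"
      by (rule sum.reindex_bij_witness[where i = "\<lambda>d. (N div d, d)" and j = snd])
         (use True in \<open>auto simp: B_def dvd_pos_nat div_greater_zero_iff dvd_imp_le\<close>)
    thus ?thesis using True by simp
  next
    case False
    hence "B N = {}" by (auto simp: B_def)
    thus ?thesis using False by simp
  qed
  finally show ?thesis .
qed

lemma zeta_q_even_nth:
  "fps_nth (zeta_q_even k) N =
     (if N > 0 then (\<Sum>d | d dvd N \<and> even d. of_nat d ^ (k - 1) / fact (k - 1)) else 0)"
  unfolding zeta_q_even_def by (rule fps_infsum_divisor_nth)

lemma zeta_q_odd_nth:
  "fps_nth (zeta_q_odd k) N =
     (if N > 0 then (\<Sum>d | d dvd N \<and> odd d. of_nat d ^ (k - 1) / fact (k - 1)) else 0)"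
  unfolding zeta_q_odd_def by (rule fps_infsum_divisor_nth)

text \<open>A product of terms has exponent (n + m) d + m e with d, e > 0. Putting D = d + e turns
  this into m D + n d with d < D, exactly the solutions in Manin's formula.\<close>

lemma zeta_q_hat_nth:
  assumes r: "r \<ge> 1" and s: "s \<ge> 1"
  shows "fps_nth (zeta_q_hat r s) N =
    (\<Sum>(m, n, D, d)\<in>manin_quads N.
       of_nat d ^ (r - 1) / fact (r - 1) * (of_nat (D - d) ^ (s - 1) / fact (s - 1)))"
proof -
  let ?A = "{(n, m). 0 < n \<and> n < m} :: (nat \<times> nat) set"
  let ?f = "\<lambda>(n, m). Q_term r (n + m) * Q_term s m"
  \<comment> \<open>The index i is the share of the exponent contributed by the first factor. The
    bounds are strict because neither factor has a constant term.\<close>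
  define I where "I x M = {i. i \<le> M \<and> 0 < i \<and> i < M \<and> fst x + snd x dvd i \<and> snd x dvd M - i}"
    for x :: "nat \<times> nat" and M
  define g where "g x i = of_nat (i div (fst x + snd x)) ^ (r - 1) / fact (r - 1) *
      (of_nat ((N - i) div snd x) ^ (s - 1) / fact (s - 1) :: rat)" for x i
  define B where "B M = {x \<in> ?A. snd x \<le> M}" for M
  have fI: "finite (I x M)" for x M by (rule finite_subset[of _ "{..M}"]) (auto simp: I_def)
  have fB: "finite (B M)" for M
    by (rule finite_subset[of _ "{..M} \<times> {..M}"]) (auto simp: B_def)
  have f0: "fps_nth (?f x) M = 0" if "x \<in> ?A" "x \<notin> B M" for x M
  proof -
    obtain n m where x: "x = (n, m)" by (cases x)
    have "fps_nth (Q_term r (n + m)) i * fps_nth (Q_term s m) (M - i) = 0" for i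
      using that by (auto simp: x B_def Q_term_nth[OF r] Q_term_nth[OF s] dest!: dvd_imp_le)
    thus ?thesis unfolding x prod.case fps_mult_nth by (intro sum.neutral) blast
  qed
  have fin: "finite {x \<in> ?A. fps_nth (?f x) M \<noteq> 0}" for M
    by (rule finite_subset[OF _ fB[of M]]) (use f0 in auto)
  have "fps_nth (zeta_q_hat r s) N = (\<Sum>x\<in>B N. fps_nth (?f x) N)"
    unfolding zeta_q_hat_def by (rule fps_infsum_nth[OF fin fB]) (use f0 in \<open>auto simp: B_def\<close>)
  also have "\<dots> = (\<Sum>x\<in>B N. \<Sum>i\<in>I x N. g x i)"
  proof (rule sum.cong[OF refl])
    fix x assume x: "x \<in> B N"
    obtain n m where xe: "x = (n, m)" by (cases x)
    have nm: "0 < n" "n < m" using x by (auto simp: xe B_def)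
    have "fps_nth (?f x) N = (\<Sum>i=0..N. fps_nth (Q_term r (n + m)) i * fps_nth (Q_term s m) (N - i))"
      by (simp add: xe fps_mult_nth)
    also have "\<dots> = (\<Sum>i\<in>I x N. fps_nth (Q_term r (n + m)) i * fps_nth (Q_term s m) (N - i))"
      by (rule sum.mono_neutral_right) (use nm in \<open>auto simp: I_def Q_term_nth[OF r] Q_term_nth[OF s] xe\<close>)
    also have "\<dots> = (\<Sum>i\<in>I x N. g x i)"
      by (rule sum.cong[OF refl]) (use nm in \<open>auto simp: I_def Q_term_nth[OF r] Q_term_nth[OF s] xe g_def\<close>)
    finally show "fps_nth (?f x) N = (\<Sum>i\<in>I x N. g x i)" .
  qed
  also have "\<dots> = (\<Sum>(x, i)\<in>Sigma (B N) (\<lambda>x. I x N). g x i)"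
    by (rule sum.Sigma) (auto simp: fB fI)
  also have "\<dots> = (\<Sum>(m, n, D, d)\<in>manin_quads N.
       of_nat d ^ (r - 1) / fact (r - 1) * (of_nat (D - d) ^ (s - 1) / fact (s - 1)))"
  proof (rule sum.reindex_bij_witness[where
        i = "\<lambda>(m, n, D, d). ((n, m), (n + m) * d)" and
        j = "\<lambda>((n, m), i). (m, n, i div (n + m) + (N - i) div m, i div (n + m))"], goal_cases)
    case (1 x)
    then obtain n m i where x: "x = ((n, m), i)" "0 < n" "n < m" "n + m dvd i"
      by (cases x) (auto simp: B_def I_def)
    thus ?case by auto
  next
    case (2 x)
    then obtain n m i where x: "x = ((n, m), i)" and *: "0 < n" "n < m" "n + m dvd i" "0 < i" "i < N" "m dvd N - i"
      by (cases x) (auto simp: B_def I_def)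
    obtain d where d: "i = (n + m) * d" using * by (auto elim: dvdE)
    obtain e where e: "N - i = m * e" using * by (auto elim: dvdE)
    have "N = (n + m) * d + m * e" using * d e by linarith
    moreover have "e > 0" using e * by (intro Nat.gr0I) auto
    moreover have "d > 0" using d * by (intro Nat.gr0I) auto
    moreover have "i div (n + m) = d" "(N - i) div m = e" using d e * by simp_all
    ultimately show ?case using * by (simp add: x manin_quads_def ring_distribs add_ac mult_ac)
  next
    case (3 x)
    then obtain m n D d where x: "x = (m, n, D, d)" and *: "0 < n" "n < m" "0 < d" "d < D" "m * D + n * d = N"
      by (auto simp: manin_quads_def)
    obtain e where e: "D = d + e" "e > 0" using less_imp_add_positive[of d D] * by auto
    have "N - (n + m) * d = m * e" using * by (simp add: e algebra_simps flip: \<open>_ = N\<close>)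
    thus ?case using * by (simp add: x e)
  next
    case (4 x)
    then obtain m n D d where x: "x = (m, n, D, d)" and *: "0 < n" "n < m" "0 < d" "d < D" "m * D + n * d = N"
      by (auto simp: manin_quads_def)
    obtain e where e: "D = d + e" "e > 0" using less_imp_add_positive[of d D] * by auto
    have N: "N = (n + m) * d + m * e" using * by (simp add: e algebra_simps)
    have "m * 1 \<le> m * e" using e by (intro mult_le_mono) auto
    hence "m \<le> N" using N by linarith
    thus ?case using * e N by (simp add: x B_def I_def)
  next
    case (5 x)
    then obtain n m i where x: "x = ((n, m), i)" by (cases x) auto
    show ?case by (simp add: x g_def)
  qed
  finally show ?thesis .
qed

section \<open>Eichler integrals\<close>

abbreviation nome :: "complex \<Rightarrow> complex" where
  "nome \<tau> \<equiv> exp (2 * of_real pi * \<i> * \<tau>)"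

lemma norm_nome: "norm (nome \<tau>) = exp (- 2 * pi * Im \<tau>)"
  by simp

lemma norm_nome_less_1: "Im \<tau> > 0 \<Longrightarrow> norm (nome \<tau>) < 1"
  by simp

lemma nome_surj:
  assumes "x \<noteq> 0" "norm x < 1"
  obtains \<tau> where "Im \<tau> > 0" "nome \<tau> = x"
proof
  define \<tau> where "\<tau> = Ln x / (2 * of_real pi * \<i>)"
  show "nome \<tau> = x" using assms by (simp add: \<tau>_def)
  hence "exp (- 2 * pi * Im \<tau>) < 1" using norm_nome[of \<tau>] assms by simp
  thus "Im \<tau> > 0" by (simp add: zero_less_mult_iff)
qed

lemma has_q_expansion_conv_radius:
  assumes "has_q_expansion f F"
  shows "fps_conv_radius F \<ge> 1"
  unfolding fps_conv_radius_def
proof (rule conv_radius_geI_ex')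
  fix r :: real assume r: "0 < r" "ereal r < 1"
  obtain \<tau> where \<tau>: "Im \<tau> > 0" "nome \<tau> = of_real r"
    using nome_surj[of "of_real r"] r by auto
  hence "(\<lambda>n. fps_nth F n * nome \<tau> ^ n) sums f \<tau>"
    using assms unfolding has_q_expansion_def upper_half_plane_def by blast
  thus "summable (\<lambda>n. fps_nth F n * of_real r ^ n)"
    unfolding \<tau>(2) by (rule sums_summable)
qed

lemma has_q_expansion_eval:
  assumes "has_q_expansion f F" "Im \<tau> > 0"
  shows "f \<tau> = eval_fps F (nome \<tau>)"
  using assms unfolding has_q_expansion_def upper_half_plane_def eval_fps_def
  by (auto simp: sums_iff)

text \<open>The nome covers the punctured unit disc, so both series agree there, then at 0 by
  continuity, and hence coefficientwise. This makes the definite description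
  \<open>q_expansion\<close> usable.\<close>

lemma has_q_expansion_unique:
  assumes F: "has_q_expansion f F" and G: "has_q_expansion f G"
  shows "F = G"
proof (rule fps_expansion_unique_complex)
  have cF: "fps_conv_radius F > 0" and cG: "fps_conv_radius G > 0"
    using has_q_expansion_conv_radius[OF F] has_q_expansion_conv_radius[OF G]
    by (auto intro: less_le_trans[of 0 1])
  show "eval_fps F has_fps_expansion F" by (rule eval_fps_has_fps_expansion[OF cF])
  have ev: "\<forall>\<^sub>F x in at 0. eval_fps F x = eval_fps G x"
    unfolding eventually_at
  proof (intro exI[of _ 1] conjI ballI impI)
    fix x :: complex assume "x \<noteq> 0 \<and> dist x 0 < 1"
    then obtain \<tau> where "Im \<tau> > 0" "nome \<tau> = x" using nome_surj[of x] by auto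
    thus "eval_fps F x = eval_fps G x"
      using has_q_expansion_eval[OF F] has_q_expansion_eval[OF G] by metis
  qed simp
  have lF: "(eval_fps F \<longlongrightarrow> eval_fps F 0) (at 0)" and lG: "(eval_fps G \<longlongrightarrow> eval_fps G 0) (at 0)"
    using continuous_eval_fps[of 0 F UNIV] continuous_eval_fps[of 0 G UNIV] cF cG
    by (auto simp: continuous_within zero_ereal_def)
  have "eval_fps F 0 = eval_fps G 0"
    by (rule LIM_unique[OF Lim_transform_eventually[OF lF ev] lG])
  with ev have "\<forall>\<^sub>F x in nhds 0. eval_fps G x = eval_fps F x"
    by (auto simp: eventually_nhds_conv_at elim: eventually_mono)
  thus "eval_fps F has_fps_expansion G"
    using eval_fps_has_fps_expansion[OF cG] unfolding has_fps_expansion_def by auto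
qed

lemma has_q_expansion_q_expansion:
  assumes "has_q_expansion f F"
  shows "has_q_expansion f (q_expansion f)"
  unfolding q_expansion_def using assms has_q_expansion_unique by (metis theI)

text \<open>Without constant term, A is X times a series bounded on the closed disc of radius exp (-
  2 pi), into which the nome maps the region Im z >= 1.\<close>

lemma eval_fps_nome_decay:
  fixes A :: "complex fps"
  assumes A0: "fps_nth A 0 = 0" and r: "fps_conv_radius A \<ge> 1"
  obtains K where "K > 0" "\<And>z. Im z \<ge> 1 \<Longrightarrow> norm (eval_fps A (nome z)) \<le> K * exp (- 2 * pi * Im z)"
proof -
  define B where "B = fps_shift 1 A"
  have AB: "A = B * fps_X" using A0
    by (intro fps_ext) (auto simp: B_def)
  have rB: "fps_conv_radius B \<ge> 1" using r by (simp add: B_def)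
  let ?D = "cball 0 (exp (- 2 * pi)) :: complex set"
  have e: "exp (- 2 * pi) < 1" by simp
  have less: "ereal (norm x) < fps_conv_radius B" if "norm x < 1" for x :: complex
    using rB that by (auto intro: less_le_trans[where y = 1])
  have "?D \<subseteq> eball 0 (fps_conv_radius B)"
  proof
    fix x :: complex assume "x \<in> ?D"
    hence "norm x \<le> exp (- 2 * pi)" by simp
    hence "norm x < 1" using e by linarith
    thus "x \<in> eball 0 (fps_conv_radius B)" using less[of x] by simp
  qed
  hence "continuous_on ?D (eval_fps B)"
    by (rule continuous_on_subset[OF continuous_on_eval_fps])
  hence "compact (eval_fps B ` ?D)" by (intro compact_continuous_image) auto
  hence "bounded (eval_fps B ` ?D)" by (rule compact_imp_bounded)
  then obtain K where K: "\<And>x. x \<in> ?D \<Longrightarrow> norm (eval_fps B x) \<le> K"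
    unfolding bounded_iff by blast
  show ?thesis
  proof (rule that[of "max K 1"])
    fix z :: complex assume z: "Im z \<ge> 1"
    have n: "norm (nome z) \<le> exp (- 2 * pi)" using z by simp
    hence n1: "norm (nome z) < 1" using e by (rule le_less_trans)
    have "eval_fps A (nome z) = eval_fps (B * fps_X) (nome z)" using AB by (rule arg_cong)
    also have "\<dots> = eval_fps B (nome z) * eval_fps fps_X (nome z)"
      by (rule eval_fps_mult[OF less[OF n1]]) (simp only: fps_conv_radius_fps_X PInfty_neq_ereal less_ereal.simps)
    finally have "eval_fps A (nome z) = eval_fps B (nome z) * nome z" by (simp only: eval_fps_X)
    hence "norm (eval_fps A (nome z)) = norm (eval_fps B (nome z)) * exp (- 2 * pi * Im z)"
      by (simp only: norm_mult norm_nome)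
    also have "\<dots> \<le> max K 1 * exp (- 2 * pi * Im z)"
      using K[of "nome z"] n by (intro mult_right_mono) auto
    finally show "norm (eval_fps A (nome z)) \<le> max K 1 * exp (- 2 * pi * Im z)" .
  qed auto
qed

section \<open>Iterated primitives of a cusp form of weight w + 2\<close>

locale cusp_form =
  fixes w :: nat and f :: "complex \<Rightarrow> complex"
  assumes even_w: "even w" and cusp: "f \<in> cusp_forms (w + 2)"
begin

abbreviation "F \<equiv> q_expansion f"

lemma modular: "f \<in> modular_forms (w + 2)" and F0: "fps_nth F 0 = 0"
  using cusp by (auto simp: cusp_forms_def)

lemma has_q_expansion_F: "has_q_expansion f F"
  using modular has_q_expansion_q_expansion by (auto simp: modular_forms_def)

lemma f_holomorphic: "f holomorphic_on upper_half_plane"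
  using modular by (simp add: modular_forms_def)

lemma f_modular:
  assumes "a * d - b * c = (1 :: int)" "Im \<tau> > 0"
  shows "f ((of_int a * \<tau> + of_int b) / (of_int c * \<tau> + of_int d)) =
           (of_int c * \<tau> + of_int d) ^ (w + 2) * f \<tau>"
  using modular assms unfolding modular_forms_def upper_half_plane_def by blast

text \<open>The j-fold primitive of f that vanishes at \<i>\<infinity>: each integration divides the
  n-th coefficient by 2 pi \<i> n. At n = 0 the coefficient is 0 because f is cuspidal.\<close>

definition eichler :: "nat \<Rightarrow> complex \<Rightarrow> complex" where
  "eichler j z = eval_fps (Abs_fps (\<lambda>n. fps_nth F n / (2 * of_real pi * \<i> * of_nat n) ^ j)) (nome z)"

lemma eichler_conv_radius:
  "fps_conv_radius (Abs_fps (\<lambda>n. fps_nth F n / (2 * of_real pi * \<i> * of_nat n) ^ j)) \<ge> 1"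
  unfolding fps_conv_radius_def fps_nth_Abs_fps
proof (rule conv_radius_geI_ex')
  fix r :: real assume r: "0 < r" "ereal r < 1"
  have "ereal (norm (of_real r :: complex)) < fps_conv_radius F"
    using r has_q_expansion_conv_radius[OF has_q_expansion_F] by (auto intro: less_le_trans[where y = 1])
  hence sm: "summable (\<lambda>n. norm (fps_nth F n * of_real r ^ n))" by (rule norm_summable_fps)
  show "summable (\<lambda>n. fps_nth F n / (2 * of_real pi * \<i> * of_nat n) ^ j * of_real r ^ n)"
  proof (rule summable_comparison_test'[OF sm])
    fix n :: nat
    show "norm (fps_nth F n / (2 * of_real pi * \<i> * of_nat n) ^ j * of_real r ^ n)
            \<le> norm (fps_nth F n * of_real r ^ n)"
    proof (cases "n = 0")
      case False
      have "1 * 1 \<le> (2 * pi) * real n"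
        using False pi_gt3 by (intro mult_mono) auto
      hence "(2 * pi * real n) ^ j \<ge> 1" by (intro one_le_power) simp
      hence "norm (fps_nth F n) / (2 * pi * real n) ^ j \<le> norm (fps_nth F n) / 1"
        by (intro divide_left_mono) auto
      hence "norm (fps_nth F n) / (2 * pi * real n) ^ j * r ^ n \<le> norm (fps_nth F n) * r ^ n"
        using r by (intro mult_right_mono) auto
      thus ?thesis using r by (simp add: norm_mult norm_divide norm_power)
    qed (use F0 in simp)
  qed
qed

lemma eichler_0:
  assumes "Im z > 0" shows "eichler 0 z = f z"
proof -
  have "Abs_fps (\<lambda>n. fps_nth F n / (2 * of_real pi * \<i> * of_nat n) ^ 0) = F"
    by (rule fps_ext) simp
  thus ?thesis using has_q_expansion_eval[OF has_q_expansion_F assms] by (simp add: eichler_def)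
qed

text \<open>On series in the nome, d/dz acts as 2 pi \<i> X d/dX, which multiplies the n-th
  coefficient by 2 pi \<i> n.\<close>

lemma eichler_deriv:
  assumes z: "Im z > 0"
  shows "(eichler (Suc j) has_field_derivative eichler j z) (at z)"
proof -
  define A where "A j = Abs_fps (\<lambda>n. fps_nth F n / (2 * of_real pi * \<i> * of_nat n) ^ j)" for j
  have rA: "fps_conv_radius (A j) \<ge> 1" for j
    unfolding A_def by (rule eichler_conv_radius)
  have n: "ereal (norm (nome z)) < 1" using norm_nome_less_1[OF z] by simp
  have less: "ereal (norm (nome z)) < fps_conv_radius B" if "fps_conv_radius B \<ge> 1" for B :: "complex fps"
    using n that by (rule less_le_trans)
  have rd: "fps_conv_radius (fps_deriv (A (Suc j))) \<ge> 1"
    using rA[of "Suc j"] fps_conv_radius_deriv[of "A (Suc j)"] by (rule order_trans)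
  have "(eval_fps (A (Suc j)) has_field_derivative eval_fps (fps_deriv (A (Suc j))) (nome z)) (at (nome z))"
    by (rule has_field_derivative_eval_fps[OF less[OF rA]])
  moreover have "(nome has_field_derivative nome z * (2 * of_real pi * \<i>)) (at z)"
    by (auto intro!: derivative_eq_intros)
  ultimately have "((\<lambda>z. eval_fps (A (Suc j)) (nome z)) has_field_derivative
      eval_fps (fps_deriv (A (Suc j))) (nome z) * (nome z * (2 * of_real pi * \<i>))) (at z)"
    by (rule DERIV_chain2[where g = nome])
  also have "eval_fps (fps_deriv (A (Suc j))) (nome z) * (nome z * (2 * of_real pi * \<i>)) =
      eval_fps (fps_deriv (A (Suc j)) * (fps_X * fps_const (2 * of_real pi * \<i>))) (nome z)"
  proof -
    have c: "fps_conv_radius (fps_X * fps_const (2 * of_real pi * \<i>) :: complex fps) \<ge> 1"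
      by (rule order_trans[OF _ fps_conv_radius_mult]) simp
    show ?thesis
      by (subst eval_fps_mult[OF less[OF rd] less[OF c]], subst eval_fps_mult) simp_all
  qed
  also have "fps_deriv (A (Suc j)) * (fps_X * fps_const (2 * of_real pi * \<i>)) = A j"
  proof (rule fps_ext)
    fix n
    have "fps_deriv (A (Suc j)) * (fps_X * fps_const (2 * of_real pi * \<i>)) =
            fps_X * (fps_deriv (A (Suc j)) * fps_const (2 * of_real pi * \<i>))"
      by (simp only: mult_ac)
    also have "fps_nth \<dots> n = fps_nth (A j) n"
    proof (cases n)
      case (Suc m)
      have "of_nat (Suc m) \<noteq> (0 :: complex)" by (rule of_nat_neq_0)
      thus ?thesis by (simp add: A_def Suc field_simps del: of_nat_Suc)
    qed (simp add: A_def F0)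
    finally show "fps_nth (fps_deriv (A (Suc j)) * (fps_X * fps_const (2 * of_real pi * \<i>))) n = fps_nth (A j) n" .
  qed
  finally show ?thesis by (simp add: eichler_def[abs_def] A_def)
qed

lemma eichler_plus_1: "eichler j (z + 1) = eichler j z"
proof -
  have "nome (z + 1) = nome z * exp (2 * of_real pi * \<i>)"
    by (simp only: distrib_left mult_1_right exp_add)
  hence "nome (z + 1) = nome z" by simp
  thus ?thesis by (simp only: eichler_def)
qed

lemma eichler_decay:
  obtains K where "K > 0" "\<And>z. Im z \<ge> 1 \<Longrightarrow> norm (eichler j z) \<le> K * exp (- 2 * pi * Im z)"
  by (rule eval_fps_nome_decay[of "Abs_fps (\<lambda>n. fps_nth F n / (2 * of_real pi * \<i> * of_nat n) ^ j)"])
     (use F0 eichler_conv_radius eichler_def in auto)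

text \<open>Exponential decay beats the polynomial factor: for t >= 1 that factor has norm at most
  (c t)^m, and exp (- 2 pi t) can be relaxed to exp (- t).\<close>

lemma eichler_tendsto_0: "((\<lambda>t. (u * Complex x t + v) ^ m * eichler j (Complex x t)) \<longlongrightarrow> 0) at_top"
proof -
  obtain K where K: "K > 0" "\<And>z. Im z \<ge> 1 \<Longrightarrow> norm (eichler j z) \<le> K * exp (- 2 * pi * Im z)"
    using eichler_decay by blast
  define c where "c = norm u * (\<bar>x\<bar> + 1) + norm v"
  show ?thesis
  proof (rule Lim_null_comparison)
    show "((\<lambda>t. c ^ m * K * (t ^ m / exp t)) \<longlongrightarrow> 0) at_top"
      by (rule tendsto_mult_right_zero[OF tendsto_power_div_exp_0])
    show "\<forall>\<^sub>F t in at_top. norm ((u * Complex x t + v) ^ m * eichler j (Complex x t)) \<le> c ^ m * K * (t ^ m / exp t)"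
      using eventually_ge_at_top[of 1]
    proof eventually_elim
      case (elim t)
      have "norm (Complex x t) \<le> \<bar>x\<bar> + \<bar>t\<bar>"
        using cmod_le[of "Complex x t"] by simp
      also have "\<dots> \<le> (\<bar>x\<bar> + 1) * t"
        using elim mult_left_mono[of 1 t "\<bar>x\<bar>"] by (simp add: algebra_simps)
      finally have "norm u * norm (Complex x t) \<le> norm u * ((\<bar>x\<bar> + 1) * t)"
        by (rule mult_left_mono) simp
      moreover have "norm v * 1 \<le> norm v * t" using elim by (intro mult_left_mono) auto
      moreover have "norm (u * Complex x t + v) \<le> norm u * norm (Complex x t) + norm v"
        using norm_triangle_ineq[of "u * Complex x t" v] by (simp add: norm_mult)
      ultimately have "norm (u * Complex x t + v) \<le> c * t"
        by (simp add: c_def algebra_simps)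
      hence 1: "norm ((u * Complex x t + v) ^ m) \<le> c ^ m * t ^ m"
        unfolding norm_power power_mult_distrib[symmetric] by (intro power_mono) auto
      have "exp (- 2 * pi * t) \<le> exp (- t)"
        using elim pi_gt3 by (simp add: mult_le_cancel_right1)
      hence "K * exp (- 2 * pi * t) \<le> K * exp (- t)" using K(1) by simp
      hence 2: "norm (eichler j (Complex x t)) \<le> K * exp (- t)"
        using K(2)[of "Complex x t"] elim by simp
      have "norm ((u * Complex x t + v) ^ m) * norm (eichler j (Complex x t)) \<le> (c ^ m * t ^ m) * (K * exp (- t))"
        using elim by (intro mult_mono 1 2) (auto simp: c_def)
      thus ?case by (simp add: norm_mult exp_minus field_simps)
    qed
  qed
qed

text \<open>The primitive of \<open>f(z) (u z + v)\<^sup>w\<close> vanishing at \<open>\<i>\<infinity>\<close>, obtained by repeated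
  integration by parts.\<close>

definition prim :: "complex \<Rightarrow> complex \<Rightarrow> complex \<Rightarrow> complex" where
  "prim u v z = (\<Sum>j\<le>w. (-1) ^ j * (fact w / fact (w - j)) * u ^ j *
     ((u * z + v) ^ (w - j) * eichler (Suc j) z))"

lemma prim_deriv:
  assumes z: "Im z > 0"
  shows "(prim u v has_field_derivative f z * (u * z + v) ^ w) (at z)"
proof -
  \<comment> \<open>The j-th summand of \<open>prim\<close> has derivative T j - T (j + 1): the
    first part from the Eichler integral, the second from the power. Setting T to 0 beyond w closes
    the telescope and leaves T 0.\<close>
  define T where "T j = (if j \<le> w then (-1) ^ j * (fact w / fact (w - j)) * u ^ j *
     ((u * z + v) ^ (w - j) * eichler j z) else 0)" for j
  have "((\<lambda>z. (-1) ^ j * (fact w / fact (w - j)) * u ^ j * ((u * z + v) ^ (w - j) * eichler (Suc j) z))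
          has_field_derivative (T j - T (Suc j))) (at z)" if "j \<le> w" for j
  proof (cases "j = w")
    case True
    show ?thesis using True
      by (auto intro!: derivative_eq_intros eichler_deriv[OF z] simp: T_def)
  next
    case False
    with that have "j < w" by simp
    then obtain i where i: "w - j = Suc i" by (cases "w - j") auto
    hence i': "w - Suc j = i" "Suc j \<le> w" using False that by auto
    show ?thesis
      unfolding i
      by (rule derivative_eq_intros eichler_deriv[OF z] refl)+
         (use i' in \<open>simp add: T_def i that field_simps del: of_nat_Suc\<close>)
  qed
  hence "(prim u v has_field_derivative (\<Sum>j\<le>w. T j - T (Suc j))) (at z)"
    unfolding prim_def by (intro DERIV_sum) auto
  also have "(\<Sum>j\<le>w. T j - T (Suc j)) = T 0 - T (Suc w)"
    by (simp only: sum_telescope)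
  also have "\<dots> = f z * (u * z + v) ^ w"
    by (simp add: T_def eichler_0[OF z])
  finally show ?thesis .
qed

lemma prim_tendsto_0: "((\<lambda>t. prim u v (Complex x t)) \<longlongrightarrow> 0) at_top"
  unfolding prim_def
  by (rule tendsto_null_sum, rule tendsto_mult_right_zero, rule eichler_tendsto_0)

lemma prim_plus_1: "prim u v (z + 1) = prim u (u + v) z"
proof -
  have "u * (z + 1) + v = u * z + (u + v)" by (simp add: algebra_simps)
  thus ?thesis by (simp only: prim_def eichler_plus_1)
qed

lemma prim_scale: "prim (c * u) (c * v) z = c ^ w * prim u v z"
  unfolding prim_def sum_distrib_left
proof (rule sum.cong[OF refl])
  fix j assume "j \<in> {..w}"
  hence "c ^ w = c ^ j * c ^ (w - j)" by (simp flip: power_add)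
  moreover have "c * u * z + c * v = c * (u * z + v)" by (simp add: algebra_simps)
  ultimately show "(-1) ^ j * (fact w / fact (w - j)) * (c * u) ^ j *
      ((c * u * z + c * v) ^ (w - j) * eichler (Suc j) z) =
    c ^ w * ((-1) ^ j * (fact w / fact (w - j)) * u ^ j * ((u * z + v) ^ (w - j) * eichler (Suc j) z))"
    by (simp add: power_mult_distrib)
qed

lemma prim_minus: "prim (- u) (- v) z = prim u v z"
  using prim_scale[of "-1" u v z] even_w by simp

lemma moebius_denom_nonzero:
  assumes "a * d - b * c = (1 :: int)" "Im z > 0"
  shows "of_int c * z + of_int d \<noteq> 0"
proof
  assume 0: "of_int c * z + of_int d = 0"
  hence "Im (of_int c * z + of_int d) = 0" by simp
  hence "c = 0" using assms by simp
  thus False using 0 assms by auto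
qed

lemma moebius_Im:
  assumes "a * d - b * c = (1 :: int)" "Im z > 0"
  shows "Im ((of_int a * z + of_int b) / (of_int c * z + of_int d)) > 0"
proof -
  define m where "m = of_int c * z + of_int d"
  have m: "m \<noteq> 0" using moebius_denom_nonzero[OF assms] by (simp add: m_def)
  have "Im ((of_int a * z + of_int b) / m) = Im ((of_int a * z + of_int b) * cnj m) / (norm m)\<^sup>2"
    by (subst complex_div_cnj) (simp add: Im_divide_of_real flip: of_real_power)
  also have "Im ((of_int a * z + of_int b) * cnj m) = real_of_int (a * d - b * c) * Im z"
    by (simp add: m_def algebra_simps)
  finally show ?thesis using assms m by (simp add: m_def)
qed

text \<open>In terms of integrals, this is the period of f(z) (u z + v)^w from \<i>\<infinity> to
  its image under the matrix. It is the constant in \<open>prim_moebius\<close>, read off at z =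
  \<i>.\<close>

definition cocycle :: "int \<Rightarrow> int \<Rightarrow> int \<Rightarrow> int \<Rightarrow> complex \<Rightarrow> complex \<Rightarrow> complex" where
  "cocycle a b c d u v = prim u v ((of_int a * \<i> + of_int b) / (of_int c * \<i> + of_int d)) -
     prim (u * of_int a + v * of_int c) (u * of_int b + v * of_int d) \<i>"

text \<open>The Moebius map has derivative (c z + d)^(-2) and turns (u z + v)^w into (U z + V)^w (c
  z + d)^(-w). Weight w + 2 cancels both factors, so the two primitives have the same derivative on
  a convex set.\<close>

lemma prim_moebius:
  assumes det: "a * d - b * c = (1 :: int)" and z: "Im z > 0"
  shows "prim u v ((of_int a * z + of_int b) / (of_int c * z + of_int d)) =
    prim (u * of_int a + v * of_int c) (u * of_int b + v * of_int d) z + cocycle a b c d u v"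
proof -
  define g where "g z = (of_int a * z + of_int b) / (of_int c * z + of_int d :: complex)" for z
  define U V where "U = u * of_int a + v * of_int c" and "V = u * of_int b + v * of_int d"
  let ?D = "\<lambda>z. prim u v (g z) - prim U V z"
  have "(?D has_field_derivative 0) (at z within {z. Im z > 0})" if "Im z > 0" for z
  proof -
    define m where "m = of_int c * z + of_int d"
    have m: "m \<noteq> 0" using moebius_denom_nonzero[OF det that] by (simp add: m_def)
    have "of_int a * of_int d - of_int b * of_int c = (of_int (a * d - b * c) :: complex)" by simp
    hence det': "of_int a * of_int d - of_int b * of_int c = (1 :: complex)" by (simp add: det)
    have "(g has_field_derivative
            (of_int a * m - (of_int a * z + of_int b) * of_int c) / (m * m)) (at z)"
      unfolding g_def by (rule derivative_eq_intros refl | use m in \<open>simp add: m_def\<close>)+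
    also have "of_int a * m - (of_int a * z + of_int b) * of_int c = 1"
      using det' by (simp add: m_def algebra_simps)
    finally have g': "(g has_field_derivative 1 / (m * m)) (at z)" .
    have gz: "Im (g z) > 0" unfolding g_def by (rule moebius_Im[OF det that])
    have "((\<lambda>z. prim u v (g z)) has_field_derivative
             (f (g z) * (u * g z + v) ^ w) * (1 / (m * m))) (at z)"
      by (rule DERIV_chain2[OF prim_deriv[OF gz] g'])
    also have "f (g z) = m ^ (w + 2) * f z"
      unfolding g_def m_def by (rule f_modular[OF det that])
    also have "u * g z + v = (U * z + V) / m"
      using m by (simp add: g_def U_def V_def m_def field_simps)
    also have "m ^ (w + 2) * f z * ((U * z + V) / m) ^ w * (1 / (m * m)) = f z * (U * z + V) ^ w"
      using m by (simp add: power_divide field_simps)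
    finally have "(?D has_field_derivative f z * (U * z + V) ^ w - f z * (U * z + V) ^ w) (at z)"
      by (intro DERIV_diff prim_deriv[OF that])
    thus ?thesis by (simp add: has_field_derivative_at_within)
  qed
  then obtain C where C: "\<And>z. Im z > 0 \<Longrightarrow> ?D z = C"
    using has_field_derivative_zero_constant[of "{z. Im z > 0}" ?D]
    by (auto simp: convex_halfspace_Im_gt)
  have "C = cocycle a b c d u v"
    using C[of \<i>] by (simp add: cocycle_def g_def U_def V_def)
  thus ?thesis using C[OF z] by (simp add: g_def U_def V_def algebra_simps)
qed

end

section \<open>Periods at rational cusps\<close>

lemma filterlim_mult_at_right_0:
  fixes c :: real
  assumes "c > 0"
  shows "filterlim (\<lambda>t. c * t) (at_right 0) (at_right 0)"
proof (rule filterlim_at_withinI)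
  show "((\<lambda>t. c * t) \<longlongrightarrow> 0) (at_right 0)" by (auto intro!: tendsto_eq_intros)
  show "\<forall>\<^sub>F t in at_right 0. c * t \<in> {0<..} - {0}"
    using assms by (auto simp: eventually_at_right_less eventually_at_filter)
qed

context cusp_form
begin

lemma cocycle_limit:
  assumes det: "a * d - b * c = (1 :: int)" and c: "c \<noteq> 0"
  shows "((\<lambda>t. prim u v (Complex (of_int a / of_int c) t)) \<longlongrightarrow> cocycle a b c d u v) (at_right 0)"
proof -
  define U V where "U = u * of_int a + v * of_int c" and "V = u * of_int b + v * of_int d"
  \<comment> \<open>The preimage of a/c + \<i> t under the matrix. It lies above - d/c at height
    1/(c^2 t), so it rises to \<i>\<infinity>, where the primitive vanishes, as t tends to
    0.\<close>
  define z where "z t = Complex (- of_int d / of_int c) (inverse ((of_int c)\<^sup>2 * t))" for t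
  have lim: "((\<lambda>t. prim U V (z t) + cocycle a b c d u v) \<longlongrightarrow> 0 + cocycle a b c d u v) (at_right 0)"
  proof (intro tendsto_add tendsto_const)
    have "filterlim (\<lambda>t. (of_int c)\<^sup>2 * t :: real) (at_right 0) (at_right 0)"
      by (rule filterlim_mult_at_right_0) (use c in simp)
    hence "filterlim (\<lambda>t. inverse ((of_int c)\<^sup>2 * t) :: real) at_top (at_right 0)"
      by (rule filterlim_compose[OF filterlim_inverse_at_top_right])
    thus "((\<lambda>t. prim U V (z t)) \<longlongrightarrow> 0) (at_right 0)"
      unfolding z_def by (rule filterlim_compose[OF prim_tendsto_0])
  qed
  have det': "of_int a * of_int d - of_int b * of_int c = (1 :: complex)"
    using arg_cong[OF det, of "of_int :: int \<Rightarrow> complex"] by simp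
  have "prim U V (z t) + cocycle a b c d u v = prim u v (Complex (of_int a / of_int c) t)" if t: "t > 0" for t
  proof -
    have Im: "Im (z t) > 0" using t c by (simp add: z_def)
    have zt: "z t = (\<i> / (of_int c * of_real t) - of_int d) / of_int c"
      using t c by (auto simp: z_def complex_eq_iff field_simps power2_eq_square)
    have m1: "of_int c * z t + of_int d = \<i> / (of_int c * of_real t)"
      using c by (simp add: zt)
    have m2: "of_int a * z t + of_int b =
        (of_int a * \<i> / (of_int c * of_real t) - (of_int a * of_int d - of_int b * of_int c)) / of_int c"
      using c by (simp add: zt field_simps)
    have "(of_int a * z t + of_int b) / (of_int c * z t + of_int d) = of_int a / of_int c + \<i> * of_real t"
      unfolding m1 m2 det' using t c by (simp add: field_simps)
    also have "\<dots> = Complex (of_int a / of_int c) t"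
      by (simp add: complex_eq_iff)
    finally show ?thesis
      using prim_moebius[OF det Im, of u v] by (simp add: U_def V_def)
  qed
  hence "\<forall>\<^sub>F t in at_right 0. prim U V (z t) + cocycle a b c d u v = prim u v (Complex (of_int a / of_int c) t)"
    by (simp add: eventually_at_filter)
  from Lim_transform_eventually[OF lim this] show ?thesis by simp
qed

text \<open>The integral of \<open>f(z) (q z - p)\<^sup>w\<close> from \<open>p / q\<close> to \<open>\<i>\<infinity>\<close>.\<close>

definition cusp_period :: "int \<Rightarrow> int \<Rightarrow> complex" where
  "cusp_period p q = - Lim (at_right 0) (\<lambda>t. prim (of_int q) (- of_int p) (Complex (of_int p / of_int q) t))"

text \<open>Arguments p, q need not be coprime: dividing by the gcd yields the cusp a/c, and Bezout
  completes the column (a, c) to determinant 1. The polynomial (q z - p)^w keeps the original p and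
  q.\<close>

lemma cusp_period_cocycle:
  assumes q: "q \<noteq> 0"
  obtains a b c d where "a * d - b * c = 1" "c \<noteq> 0" "p * c = a * q"
    "cusp_period p q = - cocycle a b c d (of_int q) (- of_int p)"
    "((\<lambda>t. prim (of_int q) (- of_int p) (Complex (of_int p / of_int q) t)) \<longlongrightarrow> - cusp_period p q) (at_right 0)"
proof -
  define g where "g = gcd p q"
  have g: "g \<noteq> 0" using q by (simp add: g_def)
  obtain a where a: "p = g * a" unfolding g_def by (metis gcd_dvd1 dvdE)
  obtain c where c: "q = g * c" unfolding g_def by (metis gcd_dvd2 dvdE)
  obtain x y where xy: "x * p + y * q = g" using bezout_int[of p q] by (auto simp: g_def)
  have "g * (a * x - (- y) * c) = g * 1" using xy a c by (simp add: algebra_simps)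
  hence det: "a * x - (- y) * c = 1" using g by (simp only: mult_cancel_left) simp
  have c0: "c \<noteq> 0" using c q by auto
  have pq: "p * c = a * q" using a c by simp
  have "of_int p * of_int c = (of_int a * of_int q :: real)"
    using arg_cong[OF pq, of "of_int :: int \<Rightarrow> real"] by simp
  hence frac: "of_int p / of_int q = (of_int a / of_int c :: real)" using q c0 by (simp add: field_simps)
  have lim: "((\<lambda>t. prim (of_int q) (- of_int p) (Complex (of_int p / of_int q) t))
              \<longlongrightarrow> cocycle a (- y) c x (of_int q) (- of_int p)) (at_right 0)"
    unfolding frac by (rule cocycle_limit[OF det c0])
  hence eq: "cusp_period p q = - cocycle a (- y) c x (of_int q) (- of_int p)"
    unfolding cusp_period_def by (subst tendsto_Lim) auto
  show ?thesis by (rule that[OF det c0 pq eq]) (use lim eq in simp)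
qed

lemma cusp_period_eqI:
  assumes "q \<noteq> 0" "a * d - b * c = 1" "c \<noteq> 0" "p * c = a * q"
  shows "cusp_period p q = - cocycle a b c d (of_int q) (- of_int p)"
proof -
  have "of_int p * of_int c = (of_int a * of_int q :: real)"
    using arg_cong[OF assms(4), of "of_int :: int \<Rightarrow> real"] by simp
  hence "of_int p / of_int q = (of_int a / of_int c :: real)" using assms by (simp add: field_simps)
  thus ?thesis unfolding cusp_period_def
    using tendsto_Lim[OF _ cocycle_limit[OF assms(2,3), of "of_int q" "- of_int p"]] by simp
qed

lemma cusp_period_limit:
  assumes "q \<noteq> 0"
  shows "((\<lambda>t. prim (of_int q) (- of_int p) (Complex (of_int p / of_int q) t)) \<longlongrightarrow> - cusp_period p q) (at_right 0)"
  using cusp_period_cocycle[OF assms] by metis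

lemma cusp_period_add: "q \<noteq> 0 \<Longrightarrow> cusp_period (p + q) q = cusp_period p q"
proof -
  assume q: "q \<noteq> 0"
  have "Complex (of_int (p + q) / of_int q) t = Complex (of_int p / of_int q) t + 1" for t
    using q by (simp add: complex_eq_iff field_simps)
  hence "prim (of_int q) (- of_int (p + q)) (Complex (of_int (p + q) / of_int q) t) =
        prim (of_int q) (- of_int p) (Complex (of_int p / of_int q) t)" for t
    by (simp add: prim_plus_1)
  thus ?thesis by (simp only: cusp_period_def)
qed

lemma cusp_period_minus: "cusp_period (- p) (- q) = cusp_period p q"
proof -
  have "prim (of_int (- q)) (- of_int (- p)) z = prim (of_int q) (- of_int p) z" for z
    using prim_minus[of "of_int q" "- of_int p"] by simp
  thus ?thesis by (simp add: cusp_period_def)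
qed

text \<open>For the inversion z -> - 1/z the image of \<i>\<infinity> is 0, so this is the period
  polynomial of f: minus the integral of f(z) (u z + v)^w from 0 to \<i>\<infinity>.\<close>

definition period_fun :: "complex \<Rightarrow> complex \<Rightarrow> complex" where
  "period_fun u v = cocycle 0 (- 1) 1 0 u v"

lemma prim_S:
  assumes "Im z > 0"
  shows "prim u v (- 1 / z) = prim v (- u) z + period_fun u v"
  using prim_moebius[of 0 0 "- 1" 1 z u v] assms by (simp add: period_fun_def)

lemma Im_S: "Im z > 0 \<Longrightarrow> Im (- 1 / z) > 0"
  using moebius_Im[of 0 0 "- 1" 1 z] by simp

text \<open>The matrix on the left is the inversion times (a, b; c, d). The path from
  \<i>\<infinity> to its cusp is split at 0, and the second piece is the inverted path from
  \<i>\<infinity> to the cusp of (a, b; c, d).\<close>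

lemma cocycle_S_mult:
  assumes det: "a * d - b * c = (1 :: int)"
  shows "cocycle (- c) (- d) a b u v = period_fun u v + cocycle a b c d v (- u)"
proof -
  have det': "(- c) * b - (- d) * a = 1" using det by (simp add: algebra_simps)
  define z where "z = (of_int a * \<i> + of_int b) / (of_int c * \<i> + of_int d)"
  have z: "Im z > 0" unfolding z_def by (rule moebius_Im[OF det]) simp
  have "(of_int (- c) * \<i> + of_int (- d)) / (of_int a * \<i> + of_int b) = - 1 / z"
    by (simp add: z_def field_simps)
  hence "prim u v (- 1 / z) = prim (u * of_int (- c) + v * of_int a) (u * of_int (- d) + v * of_int b) \<i>
           + cocycle (- c) (- d) a b u v"
    using prim_moebius[OF det', of \<i> u v] by simp
  moreover have "prim v (- u) z = prim (v * of_int a + (- u) * of_int c) (v * of_int b + (- u) * of_int d) \<i>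
           + cocycle a b c d v (- u)"
    unfolding z_def by (rule prim_moebius[OF det]) simp
  ultimately show ?thesis using prim_S[OF z, of u v] by (simp add: algebra_simps)
qed

lemma cusp_period_S:
  assumes p: "p \<noteq> 0" and q: "q \<noteq> 0"
  shows "cusp_period (- q) p = cusp_period p q - period_fun (of_int p) (of_int q)"
proof -
  obtain a b c d where *: "a * d - b * c = 1" "c \<noteq> 0" "p * c = a * q"
      "cusp_period p q = - cocycle a b c d (of_int q) (- of_int p)"
    using cusp_period_cocycle[OF q] by metis
  have "a \<noteq> 0" using * p q by auto
  moreover have "(- c) * b - (- d) * a = 1" "(- q) * a = (- c) * p" using * by (simp_all add: algebra_simps)
  ultimately have "cusp_period (- q) p = - cocycle (- c) (- d) a b (of_int p) (- of_int (- q))"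
    using p by (intro cusp_period_eqI) auto
  thus ?thesis using cocycle_S_mult[OF *(1), of "of_int p" "of_int q"] * by simp
qed

text \<open>The inversion squares to minus the identity matrix, which acts trivially because w is
  even.\<close>

lemma period_fun_S: "period_fun u v + period_fun v (- u) = 0"
proof -
  have "prim u v (- 1 / (- 1 / \<i>)) = prim v (- u) (- 1 / \<i>) + period_fun u v"
    by (rule prim_S) (rule Im_S, simp)
  moreover have "prim v (- u) (- 1 / \<i>) = prim (- u) (- v) \<i> + period_fun v (- u)"
    by (rule prim_S) simp
  ultimately show ?thesis by (simp add: prim_minus)
qed

lemma period_fun_scale: "period_fun (c * u) (c * v) = c ^ w * period_fun u v"
  using prim_scale[of c u v \<i>] prim_scale[of c v "- u" \<i>]
  by (simp add: period_fun_def cocycle_def algebra_simps)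

lemma period_fun_limit: "((\<lambda>t. prim u v (Complex 0 t)) \<longlongrightarrow> period_fun u v) (at_right 0)"
  using cocycle_limit[of 0 0 "- 1" 1 u v] by (simp add: period_fun_def)

lemma cusp_period_0:
  assumes "q \<noteq> 0"
  shows "cusp_period 0 q = of_int q ^ w * period_fun 0 1"
proof -
  have "cusp_period 0 q = - period_fun (of_int q * 1) (of_int q * 0)"
    using tendsto_Lim[OF _ period_fun_limit[of "of_int q" 0]] by (simp add: cusp_period_def)
  also have "\<dots> = - (of_int q ^ w * period_fun 1 0)"
    by (simp only: period_fun_scale)
  also have "period_fun 1 0 = - period_fun 0 1"
    using period_fun_S[of 0 1] by (simp add: add_eq_0_iff)
  finally show ?thesis by simp
qed

text \<open>Twice the even part of the period polynomial, minus the multiple of \<open>q\<^sup>w - p\<^sup>w\<close> (the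
  contribution of the Eisenstein series) that makes it vanish at \<open>(0, 1)\<close> when \<open>w > 0\<close>.\<close>

definition reduced_period :: "nat \<Rightarrow> nat \<Rightarrow> complex" where
  "reduced_period p q = period_fun (of_nat p) (of_nat q) + period_fun (- of_nat p) (of_nat q)
     - 2 * period_fun 0 1 * (of_nat q ^ w - of_nat p ^ w)"

end

section \<open>Hecke relation for periods and Manin's coefficient formula\<close>

locale cusp_eigenform = cusp_form +
  assumes eigen: "n \<ge> 1 \<Longrightarrow> Im \<tau> > 0 \<Longrightarrow> hecke (w + 2) n f \<tau> = fps_nth F n * f \<tau>"
begin

text \<open>With y = ((N/d) z + b)/d one has d y - b = (N/d) z, so integrating the eigenvalue
  equation against z^w turns each Hecke term into a primitive with polynomial (d y - b)^w. Both
  sides have the same derivative and vanish at \<i>\<infinity>.\<close>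

lemma prim_hecke:
  assumes N: "N \<ge> 1" and z: "Im z > 0"
  shows "fps_nth F N * prim 1 0 z =
    (\<Sum>d | d dvd N. \<Sum>b<d. prim (of_nat d) (- of_nat b) ((of_nat (N div d) * z + of_nat b) / of_nat d))"
proof -
  define G where "G d b z = prim (of_nat d) (- of_nat b) ((of_nat (N div d) * z + of_nat b) / of_nat d)"
    for d b :: nat and z
  define H where "H z = (\<Sum>d | d dvd N. \<Sum>b<d. G d b z)" for z
  let ?D = "\<lambda>z. fps_nth F N * prim 1 0 z - H z"
  have pos: "d > 0" "N div d > 0" "(of_nat N :: complex) = of_nat (N div d) * of_nat d" if "d dvd N" for d
    using that N dvd_imp_le[OF that] by (auto simp: dvd_pos_nat div_greater_zero_iff simp flip: of_nat_mult)
  have "(?D has_field_derivative 0) (at z within {z. Im z > 0})" if z: "Im z > 0" for z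
  proof -
    have dG: "(G d b has_field_derivative
        z ^ w * (of_nat N powi (int (w + 2) - 1) *
          (f ((of_nat (N div d) * z + of_nat b) / of_nat d) / of_nat d ^ (w + 2)))) (at z)"
      if "d dvd N" for d b
    proof -
      define y where "y = (of_nat (N div d) * z + of_nat b) / of_nat d"
      note p = pos[OF that]
      have y: "Im y > 0" using p z by (simp add: y_def)
      have dy: "of_nat d * y - of_nat b = of_nat (N div d) * z" using p by (simp add: y_def)
      have "((\<lambda>z. (of_nat (N div d) * z + of_nat b) / of_nat d) has_field_derivative
              of_nat (N div d) / of_nat d) (at z)"
        using p by (auto intro!: derivative_eq_intros)
      moreover have "(prim (of_nat d) (- of_nat b) has_field_derivative f y * (of_nat d * y + - of_nat b) ^ w)
            (at ((of_nat (N div d) * z + of_nat b) / of_nat d))"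
        unfolding y_def[symmetric] by (rule prim_deriv[OF y])
      ultimately have "(G d b has_field_derivative
          f y * (of_nat d * y + - of_nat b) ^ w * (of_nat (N div d) / of_nat d)) (at z)"
        unfolding G_def by (rule DERIV_chain2[rotated])
      also have "int (w + 2) - 1 = int (w + 1)" by simp
      hence "f y * (of_nat d * y + - of_nat b) ^ w * (of_nat (N div d) / of_nat d) =
          z ^ w * (of_nat N powi (int (w + 2) - 1) * (f y / of_nat d ^ (w + 2)))"
        using p(1) dy unfolding p(3) by (simp only: power_int_of_nat) (simp add: power_mult_distrib field_simps)
      finally show ?thesis by (simp add: y_def)
    qed
    have "(H has_field_derivative (\<Sum>d | d dvd N. \<Sum>b<d.
        z ^ w * (of_nat N powi (int (w + 2) - 1) *
          (f ((of_nat (N div d) * z + of_nat b) / of_nat d) / of_nat d ^ (w + 2))))) (at z)"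
      unfolding H_def by (intro DERIV_sum dG) auto
    also have "(\<Sum>d | d dvd N. \<Sum>b<d. z ^ w * (of_nat N powi (int (w + 2) - 1) *
          (f ((of_nat (N div d) * z + of_nat b) / of_nat d) / of_nat d ^ (w + 2)))) =
        z ^ w * hecke (w + 2) N f z"
      by (simp only: hecke_def sum_distrib_left)
    also have "hecke (w + 2) N f z = fps_nth F N * f z" by (rule eigen[OF N z])
    finally have "(H has_field_derivative z ^ w * (fps_nth F N * f z)) (at z)" .
    moreover have "((\<lambda>z. fps_nth F N * prim 1 0 z) has_field_derivative fps_nth F N * (f z * (1 * z + 0) ^ w)) (at z)"
      by (rule DERIV_cmult[OF prim_deriv[OF z]])
    ultimately have "(?D has_field_derivative fps_nth F N * (f z * (1 * z + 0) ^ w) - z ^ w * (fps_nth F N * f z)) (at z)"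
      by (rule DERIV_diff[rotated])
    thus ?thesis by (simp add: has_field_derivative_at_within mult_ac)
  qed
  then obtain C where C: "\<And>z. Im z > 0 \<Longrightarrow> ?D z = C"
    using has_field_derivative_zero_constant[of "{z. Im z > 0}" ?D]
    by (auto simp: convex_halfspace_Im_gt)
  have "((\<lambda>t. ?D (Complex 0 t)) \<longlongrightarrow> fps_nth F N * 0 - (\<Sum>d | d dvd N. \<Sum>b<d. 0)) at_top"
    unfolding H_def
  proof (intro tendsto_diff tendsto_mult tendsto_const prim_tendsto_0 tendsto_sum)
    fix d b assume "d \<in> {d. d dvd N}" "b \<in> {..<d}"
    hence p: "d > 0" "N div d > 0" using pos by auto
    have "Complex (of_nat b / of_nat d) (of_nat (N div d) / of_nat d * t) =
        (of_nat (N div d) * Complex 0 t + of_nat b) / of_nat d" for t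
      using p by (simp add: complex_eq_iff)
    moreover have "((\<lambda>t. prim (of_nat d) (- of_nat b)
        (Complex (of_nat b / of_nat d) (of_nat (N div d) / of_nat d * t))) \<longlongrightarrow> 0) at_top"
      by (rule filterlim_compose[OF prim_tendsto_0],
          rule filterlim_tendsto_pos_mult_at_top[OF tendsto_const _ filterlim_ident]) (use p in simp)
    ultimately show "((\<lambda>t. G d b (Complex 0 t)) \<longlongrightarrow> 0) at_top"
      by (simp add: G_def)
  qed
  moreover have "\<forall>\<^sub>F t in at_top. ?D (Complex 0 t) = C"
    using eventually_gt_at_top[of 0] by eventually_elim (rule C, simp)
  ultimately have "((\<lambda>_ :: real. C) \<longlongrightarrow> 0) at_top"
    using Lim_transform_eventually by force
  hence "C = 0" by (simp add: tendsto_const_iff)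
  thus ?thesis using C[OF z] by (simp add: H_def G_def)
qed

text \<open>Let z = \<i> t tend to 0 in \<open>prim_hecke\<close>: every argument descends
  vertically to its cusp b/d.\<close>

lemma cusp_period_hecke:
  assumes N: "N \<ge> 1"
  shows "(\<Sum>d | d dvd N. \<Sum>b<d. cusp_period (int b) (int d)) = fps_nth F N * period_fun 0 1"
proof -
  let ?G = "\<lambda>d b z. prim (of_nat d) (- of_nat b) ((of_nat (N div d) * z + of_nat b) / of_nat d)"
  have "((\<lambda>t. \<Sum>d | d dvd N. \<Sum>b<d. ?G d b (Complex 0 t)) \<longlongrightarrow>
          (\<Sum>d | d dvd N. \<Sum>b<d. - cusp_period (int b) (int d))) (at_right 0)"
  proof (intro tendsto_sum)
    fix d b assume d: "d \<in> {d. d dvd N}" "b \<in> {..<d}"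
    hence p: "d > 0" "N div d > 0" using N dvd_imp_le[of d N] by (auto simp: div_greater_zero_iff)
    have "Complex (of_nat b / of_nat d) (of_nat (N div d) / of_nat d * t) =
        (of_nat (N div d) * Complex 0 t + of_nat b) / of_nat d" for t
      using p by (simp add: complex_eq_iff)
    moreover have "((\<lambda>t. prim (of_int (int d)) (- of_int (int b))
        (Complex (of_int (int b) / of_int (int d)) (of_nat (N div d) / of_nat d * t)))
          \<longlongrightarrow> - cusp_period (int b) (int d)) (at_right 0)"
      by (rule filterlim_compose[OF cusp_period_limit filterlim_mult_at_right_0])
         (use p in simp_all)
    ultimately show "((\<lambda>t. ?G d b (Complex 0 t)) \<longlongrightarrow> - cusp_period (int b) (int d)) (at_right 0)"
      by simp
  qed
  moreover have "\<forall>\<^sub>F t in at_right 0. (\<Sum>d | d dvd N. \<Sum>b<d. ?G d b (Complex 0 t)) =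
      fps_nth F N * prim 1 0 (Complex 0 t)"
    using prim_hecke[OF N] by (simp add: eventually_at_filter)
  ultimately have "((\<lambda>t. fps_nth F N * prim 1 0 (Complex 0 t)) \<longlongrightarrow>
          (\<Sum>d | d dvd N. \<Sum>b<d. - cusp_period (int b) (int d))) (at_right 0)"
    by (rule Lim_transform_eventually)
  moreover have "((\<lambda>t. fps_nth F N * prim 1 0 (Complex 0 t)) \<longlongrightarrow> fps_nth F N * period_fun 1 0) (at_right 0)"
    by (intro tendsto_mult tendsto_const period_fun_limit)
  ultimately have "(\<Sum>d | d dvd N. \<Sum>b<d. - cusp_period (int b) (int d)) = fps_nth F N * period_fun 1 0"
    by (rule tendsto_unique[rotated]) simp
  moreover have "period_fun 1 0 = - period_fun 0 1"
    using period_fun_S[of 0 1] by (simp add: add_eq_0_iff)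
  ultimately show ?thesis by (simp add: sum_negf)
qed

theorem manin_coefficient_formula:
  assumes N: "N \<ge> 1"
  shows "2 * period_fun 0 1 * (fps_nth F N - (\<Sum>d | d dvd N. of_nat d ^ (w + 1))) =
    2 * (\<Sum>(m, n, D, d)\<in>manin_quads N. reduced_period d D) +
    (\<Sum>D | D dvd N. 2 * (\<Sum>b | 0 < b \<and> 2 * b < D. reduced_period b D) +
       (if even D then reduced_period (D div 2) D else 0))"
proof -
  define c where "c = period_fun 0 1"
  \<comment> \<open>For q > 0 the formula already gives 0 at p = 0, by \<open>cusp_period_0\<close>.
    The explicit zeros extend the hypotheses of \<open>manin_sum\<close> to q = 0, where no period
    is available.\<close>
  define h where "h p q = (if p = 0 \<or> q = 0 then 0 else
    cusp_period (int p) (int q) + cusp_period (- int p) (int q) - 2 * c * of_nat q ^ w)" for p q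
  have h_eq: "h p q = cusp_period (int p) (int q) + cusp_period (- int p) (int q) - 2 * c * of_nat q ^ w"
    if "q > 0" for p q
    using that cusp_period_0[of "int q"] by (simp add: h_def c_def)
  have "(\<Sum>D | D dvd N. \<Sum>b<D. h b D) =
    2 * (\<Sum>(m, n, D, d)\<in>manin_quads N. reduced_period d D) +
    (\<Sum>D | D dvd N. 2 * (\<Sum>b | 0 < b \<and> 2 * b < D. reduced_period b D) +
       (if even D then reduced_period (D div 2) D else 0))"
  proof (rule manin_sum)
    show "h 0 q = 0" for q by (simp add: h_def)
    show "h (p + q) q = h p q" for p q
    proof (cases "q = 0")
      case False
      hence "cusp_period (int p + int q) (int q) = cusp_period (int p) (int q)"
          "cusp_period (- int p - int q + int q) (int q) = cusp_period (- int p - int q) (int q)"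
        by (intro cusp_period_add; simp)+
      thus ?thesis using False by (simp add: h_eq)
    qed (simp add: h_def)
    show "h (q - p) q = h p q" if "p \<le> q" for p q
    proof (cases "q = 0")
      case False
      hence "cusp_period (- int p + int q) (int q) = cusp_period (- int p) (int q)"
          "cusp_period (int p - int q + int q) (int q) = cusp_period (int p - int q) (int q)"
        by (intro cusp_period_add; simp)+
      thus ?thesis using False that by (simp add: h_eq of_nat_diff)
    qed (simp add: h_def)
    show "h p q - h q p = reduced_period p q" if "p > 0" "q > 0" for p q
    proof -
      have 1: "cusp_period (- int q) (int p) = cusp_period (int p) (int q) - period_fun (of_nat p) (of_nat q)"
        using cusp_period_S[of "int p" "int q"] that by simp
      have 2: "cusp_period (int q) (int p) = cusp_period (- int p) (int q) - period_fun (- of_nat p) (of_nat q)"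
        using cusp_period_S[of "- int p" "int q"] cusp_period_minus[of "int q" "int p"] that by simp
      show ?thesis using that by (simp add: h_eq 1 2 reduced_period_def c_def algebra_simps)
    qed
  qed (use N in simp)
  \<comment> \<open>Negation permutes the residues modulo D, so the even part doubles the Hecke sum,
    while D copies of the correction 2 c D^w add up to 2 c D^(w+1).\<close>
  also have "(\<Sum>D | D dvd N. \<Sum>b<D. h b D) = 2 * c * (fps_nth F N - (\<Sum>d | d dvd N. of_nat d ^ (w + 1)))"
  proof -
    have "(\<Sum>b<D. h b D) = 2 * (\<Sum>b<D. cusp_period (int b) (int D)) - 2 * c * of_nat D ^ (w + 1)"
      if "D dvd N" for D
    proof -
      have D: "D > 0" using that N by (intro Nat.gr0I) auto
      \<comment> \<open>The outer \<open>mod\<close> sends b = 0 to 0 instead of D, which keeps the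
        index inside the range of summation.\<close>
      have per: "cusp_period (- int b) (int D) = cusp_period (int ((D - b) mod D)) (int D)" if "b < D" for b
      proof (cases "b = 0")
        case False
        thus ?thesis using that cusp_period_add[of "int D" "- int b"] by (simp add: of_nat_diff)
      qed simp
      have "(\<Sum>b<D. cusp_period (- int b) (int D)) = (\<Sum>b<D. cusp_period (int ((D - b) mod D)) (int D))"
        by (intro sum.cong refl) (simp add: per)
      also have "\<dots> = (\<Sum>b<D. cusp_period (int b) (int D))"
      proof (rule sum.reindex_bij_witness[where i = "\<lambda>b. (D - b) mod D" and j = "\<lambda>b. (D - b) mod D"])
        have inv: "(D - (D - b) mod D) mod D = b" if "b < D" for b
          using that by (cases "b = 0") auto
        show "\<And>b. b \<in> {..<D} \<Longrightarrow> (D - (D - b) mod D) mod D = b" using inv by simp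
        thus "\<And>b. b \<in> {..<D} \<Longrightarrow> (D - (D - b) mod D) mod D = b" .
      qed (use D in auto)
      finally have "(\<Sum>b<D. cusp_period (- int b) (int D)) = (\<Sum>b<D. cusp_period (int b) (int D))" .
      thus ?thesis using D by (simp add: h_eq sum.distrib sum_subtractf)
    qed
    hence "(\<Sum>D | D dvd N. \<Sum>b<D. h b D) =
        2 * (\<Sum>D | D dvd N. \<Sum>b<D. cusp_period (int b) (int D)) - 2 * c * (\<Sum>D | D dvd N. of_nat D ^ (w + 1))"
      by (simp add: sum_subtractf sum_distrib_left)
    thus ?thesis using cusp_period_hecke[OF N] by (simp add: c_def algebra_simps)
  qed
  finally show ?thesis by (simp add: c_def)
qed

end

section \<open>The completed L-function\<close>

text \<open>By the identity theorem L and H agree off a sparse set. At any z, L therefore tends to H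
  z, so z is no pole, and a nicely meromorphic function takes its limit as its value.\<close>

lemma nicely_meromorphic_eq_analyticI:
  assumes L: "L nicely_meromorphic_on UNIV" and H: "H analytic_on UNIV"
    and eq: "\<And>s. Re s > \<sigma> \<Longrightarrow> L s = H s"
  shows "L = H"
proof
  fix z
  have "(\<lambda>s. L s - H s) meromorphic_on UNIV"
    using L analytic_on_imp_meromorphic_on[OF H] unfolding nicely_meromorphic_on_def
    by (intro meromorphic_on_diff) auto
  hence "(\<forall>\<^sub>\<approx>s\<in>UNIV. L s - H s = 0) \<or> (\<forall>\<^sub>\<approx>s\<in>UNIV. L s - H s \<noteq> 0)"
    by (intro meromorphic_imp_constant_or_avoid) auto
  moreover have "\<not> (\<forall>\<^sub>\<approx>s\<in>UNIV. L s - H s \<noteq> 0)"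
  proof
    define s0 where "s0 = complex_of_real (\<sigma> + 1)"
    assume "\<forall>\<^sub>\<approx>s\<in>UNIV. L s - H s \<noteq> 0"
    hence "\<forall>\<^sub>F s in at s0. L s - H s \<noteq> 0" by (simp add: eventually_cosparse_open_eq)
    moreover have "\<forall>\<^sub>F s in at s0. s \<in> {s. Re s > \<sigma>}"
      by (rule eventually_at_in_open') (auto simp: s0_def open_halfspace_Re_gt)
    ultimately have "\<forall>\<^sub>F s in at s0. False" by eventually_elim (simp add: eq)
    thus False by simp
  qed
  ultimately have "\<forall>\<^sub>\<approx>s\<in>UNIV. L s - H s = 0" by blast
  hence ev: "\<forall>\<^sub>F s in at z. L s = H s"
    by (simp add: eventually_cosparse_open_eq)
  have lim: "H \<midarrow>z\<rightarrow> H z"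
    using H by (meson analytic_at_imp_isCont analytic_on_analytic_at UNIV_I isContD)
  hence lim': "L \<midarrow>z\<rightarrow> H z"
    by (rule Lim_transform_eventually) (use ev in \<open>simp add: eq_commute\<close>)
  hence "\<not> is_pole L z"
    using not_tendsto_and_filterlim_at_infinity[of "at z" L "H z"] by (auto simp: is_pole_def)
  hence "L \<midarrow>z\<rightarrow> L z" using L by (auto simp: nicely_meromorphic_on_def)
  thus "L z = H z" using lim' by (rule LIM_unique)
qed

lemma power_le_fact_exp:
  fixes x :: real
  assumes "x \<ge> 0"
  shows "x ^ n \<le> fact n * exp x"
proof -
  have "(\<Sum>k\<in>{n}. x ^ k /\<^sub>R fact k) \<le> exp x"
    unfolding exp_def using assms by (intro sum_le_suminf summable_exp_generic) auto
  thus ?thesis by (simp add: field_simps)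
qed

lemma exp_minus_has_integral: "((\<lambda>t. K * exp (- t)) has_integral K) {0<..}" for K :: real
proof -
  have "((\<lambda>t. exp (- 1 * t)) has_integral exp (- 1 * 0) / 1) {0::real..}"
    by (rule has_integral_exp_minus_to_infinity) simp
  hence "((\<lambda>t. exp (- t)) has_integral 1) {0::real..}" by simp
  moreover have "{0::real..} - {0<..} = {0}" by auto
  ultimately have "((\<lambda>t. exp (- t)) has_integral 1) (interior {0::real..})"
    by (subst has_integral_interior) (simp_all add: frontier_def)
  hence "((\<lambda>t. exp (- t)) has_integral 1) {0::real<..}" by simp
  from has_integral_mult_right[OF this, of K] show ?thesis by simp
qed

text \<open>Compact windows exhausting the half line. On each of them one may differentiate under
  the Mellin integral and apply the fundamental theorem of calculus to the primitive.\<close>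

definition trunc :: "nat \<Rightarrow> real set" where
  "trunc n = {1 / real (Suc n)..real (Suc n)}"

lemma trunc_subset: "trunc n \<subseteq> {0<..}"
  by (auto simp: trunc_def intro: less_le_trans[rotated])

lemma trunc_endpoints: "1 / real (Suc n) \<le> real (Suc n)"
proof -
  have "1 / real (Suc n) \<le> 1" by simp
  also have "1 \<le> real (Suc n)" by simp
  finally show ?thesis .
qed

text \<open>The integral of exp (- t) over the part of the half line outside the window.\<close>

definition trunc_error :: "nat \<Rightarrow> real" where
  "trunc_error n = 1 - (exp (- (1 / real (Suc n))) - exp (- real (Suc n)))"

lemma trunc_error_tendsto: "trunc_error \<longlonglongrightarrow> 0"
  unfolding trunc_error_def by real_asymp

lemma exp_dominated_integral:
  fixes g :: "real \<Rightarrow> complex"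
  assumes cont: "continuous_on {0<..} g" and bound: "\<And>t. t > 0 \<Longrightarrow> norm (g t) \<le> K * exp (- t)"
  shows "g integrable_on {0<..}"
    and "norm (integral {0<..} g - integral (trunc n) g) \<le> K * trunc_error n"
proof -
  show int: "g integrable_on {0<..}"
  proof (rule measurable_bounded_by_integrable_imp_integrable)
    show "g \<in> borel_measurable (lebesgue_on {0<..})"
      by (rule continuous_imp_measurable_on_sets_lebesgue[OF cont]) auto
    show "(\<lambda>t. K * exp (- t)) integrable_on {0<..}"
      using exp_minus_has_integral by (rule has_integral_integrable)
  qed (use bound in auto)
  have int': "g integrable_on trunc n"
    unfolding trunc_def using continuous_on_subset[OF cont trunc_subset[of n]]
    by (intro integrable_continuous_interval) (simp add: trunc_def)
  have "((\<lambda>t. K * exp (- t)) has_integral (- K * exp (- real (Suc n))) - (- K * exp (- (1 / real (Suc n))))) (trunc n)"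
    unfolding trunc_def
    by (rule fundamental_theorem_of_calculus[OF trunc_endpoints])
       (auto intro!: derivative_eq_intros simp flip: has_real_derivative_iff_has_vector_derivative)
  from has_integral_setdiff[OF exp_minus_has_integral[of K] this]
  have d: "((\<lambda>t. K * exp (- t)) has_integral K * trunc_error n) ({0<..} - trunc n)"
    using trunc_subset[of n] by (simp add: trunc_error_def algebra_simps)
  have "integral {0<..} g - integral (trunc n) g = integral ({0<..} - trunc n) g"
    using int int' trunc_subset[of n] by (simp add: integral_setdiff)
  also have "norm \<dots> \<le> integral ({0<..} - trunc n) (\<lambda>t. K * exp (- t))"
  proof (rule Henstock_Kurzweil_Integration.integral_norm_bound_integral)
    show "g integrable_on ({0<..} - trunc n)"
      using int int' trunc_subset[of n] by (intro integrable_setdiff[of g _ "{0<..}"] integrable_integral) auto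
  qed (use d bound in auto)
  also have "\<dots> = K * trunc_error n" using d by (rule integral_unique)
  finally show "norm (integral {0<..} g - integral (trunc n) g) \<le> K * trunc_error n" .
qed

context cusp_form
begin

lemma f_continuous_axis: "continuous_on {0<..} (\<lambda>t. f (\<i> * of_real t))"
proof -
  have "continuous_on ((\<lambda>t. \<i> * of_real t) ` {0<..}) f"
    by (rule continuous_on_subset[OF holomorphic_on_imp_continuous_on[OF f_holomorphic]])
       (auto simp: upper_half_plane_def)
  thus ?thesis
    by (rule continuous_on_compose2[OF _ _ order_refl]) (intro continuous_intros)
qed

text \<open>For t >= 1 the q-expansion decays; for t < 1 modularity gives f(\<i> t) = (\<i>/t)^(w+2)
  f(\<i>/t), exponentially small in 1/t. The factor t^\<rho> + (1/t)^\<rho> dominates |t^(s-1)| on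
  the whole strip |Re s - 1| <= \<rho>, so one integrable majorant serves all such s.\<close>

lemma f_axis_bound:
  obtains K where "\<And>t. t > 0 \<Longrightarrow> norm (f (\<i> * of_real t)) * (t ^ \<rho> + (1 / t) ^ \<rho>) \<le> K * exp (- t)"
proof -
  obtain K where K: "K > 0" "\<And>z. Im z \<ge> 1 \<Longrightarrow> norm (eichler 0 z) \<le> K * exp (- 2 * pi * Im z)"
    using eichler_decay by blast
  have big: "norm (f (\<i> * of_real t)) \<le> K * exp (- 2 * t)" if "t \<ge> 1" for t
  proof -
    have "norm (f (\<i> * of_real t)) \<le> K * exp (- 2 * pi * t)"
      using K(2)[of "\<i> * of_real t"] eichler_0[of "\<i> * of_real t"] that by simp
    also have "exp (- 2 * pi * t) \<le> exp (- 2 * t)"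
      using that pi_gt3 by simp
    finally show ?thesis using K(1) by simp
  qed
  \<comment> \<open>The power of 1/t when t < 1: w + 2 from modularity and \<rho> from the weight.
    In M, the factorials come from x^n <= n! exp x, and exp 1 from exp (- 1/t) <= exp (1 - t) for t
    < 1.\<close>
  define n where "n = w + 2 + \<rho>"
  define M where "M = 2 * K * (fact \<rho> + fact n * exp 1)"
  have "norm (f (\<i> * of_real t)) * (t ^ \<rho> + (1 / t) ^ \<rho>) \<le> M * exp (- t)" if t: "t > 0" for t
  proof (cases "t \<ge> 1")
    case True
    have "(1 / t) ^ \<rho> \<le> t ^ \<rho>" using True by (intro power_mono) (auto simp: field_simps intro: order_trans[of 1 t])
    hence "norm (f (\<i> * of_real t)) * (t ^ \<rho> + (1 / t) ^ \<rho>) \<le> (K * exp (- 2 * t)) * (2 * (fact \<rho> * exp t))"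
      using True power_le_fact_exp[of t \<rho>] K(1) by (intro mult_mono big) auto
    also have "\<dots> = 2 * K * fact \<rho> * (exp (- 2 * t) * exp t)" by simp
    also have "exp (- 2 * t) * exp t = exp (- t)" by (simp flip: exp_add)
    also have "2 * K * fact \<rho> * exp (- t) \<le> M * exp (- t)"
      using K(1) by (intro mult_right_mono) (auto simp: M_def algebra_simps)
    finally show ?thesis .
  next
    case False
    define x where "x = 1 / t"
    have x: "x \<ge> 1" "t = 1 / x" using False t by (auto simp: x_def)
    have "f ((of_int 0 * (\<i> * of_real x) + of_int (- 1)) / (of_int 1 * (\<i> * of_real x) + of_int 0)) =
        (of_int 1 * (\<i> * of_real x) + of_int 0) ^ (w + 2) * f (\<i> * of_real x)"
      by (rule f_modular) (use x in auto)
    moreover have "(of_int 0 * (\<i> * of_real x) + of_int (- 1)) / (of_int 1 * (\<i> * of_real x) + of_int 0) = \<i> * of_real t"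
      unfolding x(2) using x(1) by (simp add: field_simps)
    ultimately have "f (\<i> * of_real t) = (\<i> * of_real x) ^ (w + 2) * f (\<i> * of_real x)"
      by simp
    hence nf: "norm (f (\<i> * of_real t)) = x ^ (w + 2) * norm (f (\<i> * of_real x))"
      using x by (simp only: norm_mult norm_power norm_ii norm_of_real) simp
    have "t ^ \<rho> \<le> x ^ \<rho>" using False t x(1) by (intro power_mono) linarith+
    hence "t ^ \<rho> + (1 / t) ^ \<rho> \<le> 2 * x ^ \<rho>" unfolding x_def by simp
    moreover have "x ^ (w + 2) * norm (f (\<i> * of_real x)) \<le> x ^ (w + 2) * (K * exp (- 2 * x))"
      using x(1) by (intro mult_left_mono big) simp_all
    ultimately have "norm (f (\<i> * of_real t)) * (t ^ \<rho> + (1 / t) ^ \<rho>) \<le> (x ^ (w + 2) * (K * exp (- 2 * x))) * (2 * x ^ \<rho>)"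
      unfolding nf using x(1) t K(1) by (intro mult_mono) simp_all
    also have "\<dots> = 2 * K * exp (- 2 * x) * x ^ n"
      by (simp add: n_def power_add)
    also have "\<dots> \<le> 2 * K * exp (- 2 * x) * (fact n * exp x)"
      using K(1) x by (intro mult_left_mono power_le_fact_exp) auto
    also have "\<dots> = 2 * K * fact n * (exp (- 2 * x) * exp x)" by simp
    also have "exp (- 2 * x) * exp x = exp (- x)" by (simp flip: exp_add)
    also have "exp (- x) \<le> exp 1 * exp (- t)"
      unfolding exp_add[symmetric] using x(1) False by simp
    also have "2 * K * fact n * (exp 1 * exp (- t)) \<le> M * exp (- t)"
      using K(1) by (simp add: M_def algebra_simps)
    finally show ?thesis using K(1) by simp
  qed
  thus ?thesis by (rule that)
qed

text \<open>Written with exp and the real logarithm rather than \<open>powr\<close>, so that the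
  integrand is visibly entire in s, with ln t as the factor produced by differentiation.\<close>

definition mellin :: "complex \<Rightarrow> real \<Rightarrow> complex" where
  "mellin s t = f (\<i> * of_real t) * exp ((s - 1) * of_real (ln t))"

lemma mellin_continuous: "continuous_on {0<..} (mellin s)"
  unfolding mellin_def by (intro continuous_intros f_continuous_axis) auto

lemma mellin_bound:
  obtains K where "\<And>s t. \<bar>Re s - 1\<bar> \<le> real \<rho> \<Longrightarrow> t > 0 \<Longrightarrow> norm (mellin s t) \<le> K * exp (- t)"
proof -
  obtain K where K: "\<And>t. t > 0 \<Longrightarrow> norm (f (\<i> * of_real t)) * (t ^ \<rho> + (1 / t) ^ \<rho>) \<le> K * exp (- t)"
    using f_axis_bound by blast
  have "norm (mellin s t) \<le> K * exp (- t)" if s: "\<bar>Re s - 1\<bar> \<le> real \<rho>" and t: "t > 0" for s t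
  proof -
    have "(Re s - 1) * ln t \<le> \<bar>Re s - 1\<bar> * \<bar>ln t\<bar>" by (metis abs_ge_self abs_mult)
    also have "\<dots> \<le> real \<rho> * \<bar>ln t\<bar>" using s by (intro mult_right_mono) auto
    finally have "exp ((Re s - 1) * ln t) \<le> exp (real \<rho> * \<bar>ln t\<bar>)" by simp
    also have "\<dots> = exp \<bar>ln t\<bar> ^ \<rho>" by (rule exp_of_nat_mult)
    also have "\<dots> \<le> t ^ \<rho> + (1 / t) ^ \<rho>"
    proof (cases "t \<ge> 1")
      case True
      thus ?thesis using t by simp
    next
      case False
      hence "exp \<bar>ln t\<bar> = 1 / t" using t by (simp add: exp_minus field_simps)
      thus ?thesis using t by simp
    qed
    finally have "norm (exp ((s - 1) * of_real (ln t))) \<le> t ^ \<rho> + (1 / t) ^ \<rho>"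
      by (simp add: norm_exp_eq_Re)
    hence "norm (mellin s t) \<le> norm (f (\<i> * of_real t)) * (t ^ \<rho> + (1 / t) ^ \<rho>)"
      unfolding mellin_def norm_mult by (rule mult_left_mono) simp
    also have "\<dots> \<le> K * exp (- t)" by (rule K[OF t])
    finally show ?thesis .
  qed
  thus ?thesis by (rule that)
qed

definition mellin_int :: "complex \<Rightarrow> complex" where
  "mellin_int s = integral {0<..} (mellin s)"

lemma mellin_has_integral: "(mellin s has_integral mellin_int s) {0<..}"
proof -
  obtain \<rho> :: nat where "\<bar>Re s - 1\<bar> \<le> real \<rho>" using real_arch_simple by blast
  then obtain K where "\<And>t. t > 0 \<Longrightarrow> norm (mellin s t) \<le> K * exp (- t)"
    using mellin_bound[of \<rho>] by metis
  thus ?thesis unfolding mellin_int_def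
    by (intro integrable_integral exp_dominated_integral(1) mellin_continuous)
qed

lemma mellin_trunc_uniform:
  "uniform_limit (cball x 1) (\<lambda>n s. integral (trunc n) (mellin s)) mellin_int sequentially"
proof -
  \<comment> \<open>On the unit disc around x one has |Re s - 1| <= |x| + 2, so a single strip bound
    covers the disc.\<close>
  obtain \<rho> :: nat where \<rho>: "norm x + 2 \<le> real \<rho>" using real_arch_simple by blast
  obtain K where K: "\<And>s t. \<bar>Re s - 1\<bar> \<le> real \<rho> \<Longrightarrow> t > 0 \<Longrightarrow> norm (mellin s t) \<le> K * exp (- t)"
    using mellin_bound[of \<rho>] by metis
  have bnd: "norm (integral (trunc n) (mellin s) - mellin_int s) \<le> K * trunc_error n"
    if s: "s \<in> cball x 1" for s n
  proof -
    have "norm s \<le> norm x + 1" using s norm_triangle_ineq2[of s x] by (simp add: dist_norm norm_minus_commute)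
    hence "\<bar>Re s - 1\<bar> \<le> real \<rho>" using \<rho> abs_Re_le_cmod[of s] by linarith
    from exp_dominated_integral(2)[OF mellin_continuous K[OF this]]
    show ?thesis unfolding mellin_int_def by (subst norm_minus_commute) auto
  qed
  show ?thesis
  proof (rule uniform_limitI)
    fix e :: real assume "e > 0"
    have "(\<lambda>n. K * trunc_error n) \<longlonglongrightarrow> 0"
      by (rule tendsto_mult_right_zero[OF trunc_error_tendsto])
    hence "\<forall>\<^sub>F n in sequentially. K * trunc_error n < e"
      using \<open>e > 0\<close> by (rule order_tendstoD)
    thus "\<forall>\<^sub>F n in sequentially. \<forall>s\<in>cball x 1. dist (integral (trunc n) (mellin s)) (mellin_int s) < e"
    proof eventually_elim
      case (elim n)
      show ?case
      proof
        fix s assume "s \<in> cball x 1"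
        from le_less_trans[OF bnd[OF this] elim]
        show "dist (integral (trunc n) (mellin s)) (mellin_int s) < e" by (simp only: dist_norm)
      qed
    qed
  qed
qed

lemma mellin_trunc_tendsto: "(\<lambda>n. integral (trunc n) (mellin s)) \<longlonglongrightarrow> mellin_int s"
  by (rule tendsto_uniform_limitI[OF mellin_trunc_uniform[of s]]) simp

lemma mellin_int_holomorphic: "mellin_int holomorphic_on UNIV"
proof (rule holomorphic_uniform_sequence)
  show "(\<lambda>s. integral (trunc n) (mellin s)) holomorphic_on UNIV" for n
    unfolding trunc_def box_real[symmetric]
  proof (rule leibniz_rule_holomorphic)
    fix s t assume "t \<in> cbox (1 / real (Suc n)) (real (Suc n))"
    show "((\<lambda>s. mellin s t) has_field_derivative mellin s t * of_real (ln t)) (at s within UNIV)"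
      unfolding mellin_def by (auto intro!: derivative_eq_intros)
  next
    fix s
    show "mellin s integrable_on cbox (1 / real (Suc n)) (real (Suc n))"
      using continuous_on_subset[OF mellin_continuous trunc_subset[of n], of s]
      by (intro integrable_continuous) (simp add: trunc_def)
  next
    have sub: "UNIV \<times> cbox (1 / real (Suc n)) (real (Suc n)) \<subseteq> {x :: complex \<times> real. snd x \<in> {0<..}}"
      using trunc_subset[of n] by (auto simp: trunc_def)
    have "continuous_on {x :: complex \<times> real. snd x \<in> {0<..}} (\<lambda>x. f (\<i> * of_real (snd x)))"
      by (rule continuous_on_compose2[OF f_continuous_axis]) (auto intro!: continuous_intros)
    hence "continuous_on {x :: complex \<times> real. snd x \<in> {0<..}}
        (\<lambda>x. f (\<i> * of_real (snd x)) * exp ((fst x - 1) * of_real (ln (snd x))) * of_real (ln (snd x)))"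
      by (intro continuous_intros) auto
    from continuous_on_subset[OF this sub]
    show "continuous_on (UNIV \<times> cbox (1 / real (Suc n)) (real (Suc n))) (\<lambda>(s, t). mellin s t * of_real (ln t))"
      by (simp add: mellin_def case_prod_unfold)
  qed auto
qed (use mellin_trunc_uniform in \<open>auto intro!: exI[of _ 1]\<close>)

text \<open>For a cusp form the Mellin integral converges at every s and is entire, hence is its own
  continuation. Uniqueness for the definite description comes from
  \<open>nicely_meromorphic_eq_analyticI\<close>.\<close>

lemma completed_L_eq: "completed_L f = mellin_int"
proof -
  let ?P = "\<lambda>L. L nicely_meromorphic_on UNIV \<and> (\<exists>\<sigma>::real. \<forall>s. Re s > \<sigma> \<longrightarrow>
        ((\<lambda>y::real. (f (\<i> * of_real y) - fps_nth (q_expansion f) 0) * of_real y powr (s - 1))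
           has_integral L s) {0<..})"
  have int: "((\<lambda>y::real. (f (\<i> * of_real y) - fps_nth (q_expansion f) 0) * of_real y powr (s - 1))
           has_integral mellin_int s) {0<..}" for s
    using mellin_has_integral[of s]
    by (rule has_integral_eq[rotated]) (auto simp: mellin_def F0 powr_def Ln_of_real)
  have an: "mellin_int analytic_on UNIV"
    using mellin_int_holomorphic by (simp add: analytic_on_open)
  have "?P mellin_int" using int an by (auto intro: analytic_on_imp_nicely_meromorphic_on)
  moreover have "L = mellin_int" if L: "?P L" for L
  proof -
    obtain \<sigma> where "\<And>s. Re s > \<sigma> \<Longrightarrow>
        ((\<lambda>y::real. (f (\<i> * of_real y) - fps_nth (q_expansion f) 0) * of_real y powr (s - 1))
           has_integral L s) {0<..}" using L by blast
    hence "L s = mellin_int s" if "Re s > \<sigma>" for s using that int has_integral_unique by blast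
    thus ?thesis using L an by (intro nicely_meromorphic_eq_analyticI) auto
  qed
  ultimately have "(THE L. ?P L) = mellin_int" by (rule the_equality)
  thus ?thesis by (simp add: completed_L_def)
qed

section \<open>L-values as coefficients of the period polynomial\<close>

lemma period_fun_sum:
  "period_fun u v =
     - (\<Sum>m\<le>w. of_nat (w choose m) * u ^ m * v ^ (w - m) * \<i> ^ (m + 1) * completed_L f (of_nat (m + 1)))"
proof -
  define c where "c m = of_nat (w choose m) * u ^ m * v ^ (w - m) * \<i> ^ (m + 1)" for m
  define I where "I n = (\<Sum>m\<le>w. c m * integral (trunc n) (mellin (of_nat (m + 1))))" for n
  have "I \<longlonglongrightarrow> (\<Sum>m\<le>w. c m * mellin_int (of_nat (m + 1)))"
    unfolding I_def
    by (intro tendsto_sum tendsto_mult tendsto_const mellin_trunc_tendsto)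
  \<comment> \<open>The integral over a window is evaluated twice: by binomial expansion of (u \<i>
    t + v)^w into Mellin integrals, and by the boundary values of \<open>prim\<close>, whose limits
    are 0 at the top and the period at the bottom.\<close>
  moreover have "I = (\<lambda>n. prim u v (Complex 0 (real (Suc n))) - prim u v (Complex 0 (1 / real (Suc n))))"
  proof
    fix n
    have "((\<lambda>t. \<Sum>m\<le>w. c m * mellin (of_nat (m + 1)) t) has_integral I n) (trunc n)"
      unfolding I_def
    proof (intro has_integral_sum has_integral_mult_right integrable_integral)
      show "mellin s integrable_on trunc n" for s
        unfolding trunc_def using continuous_on_subset[OF mellin_continuous trunc_subset[of n], of s]
        by (intro integrable_continuous_interval) (simp add: trunc_def)
    qed auto
    moreover have "((\<lambda>t. \<Sum>m\<le>w. c m * mellin (of_nat (m + 1)) t) has_integral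
        prim u v (Complex 0 (real (Suc n))) - prim u v (Complex 0 (1 / real (Suc n)))) (trunc n)"
      unfolding trunc_def
    proof (rule fundamental_theorem_of_calculus[OF trunc_endpoints])
      fix t assume "t \<in> {1 / real (Suc n)..real (Suc n)}"
      hence t: "t > 0" using trunc_subset[of n] by (auto simp: trunc_def)
      have C: "Complex 0 t = \<i> * of_real t" by (simp add: complex_eq_iff)
      have "((\<lambda>t. prim u v (Complex 0 t)) has_vector_derivative
              \<i> * (f (Complex 0 t) * (u * Complex 0 t + v) ^ w)) (at t within {1 / real (Suc n)..real (Suc n)})"
      proof -
        have "((\<lambda>t. Complex 0 t) has_vector_derivative \<i>) (at t within {1 / real (Suc n)..real (Suc n)})"
          unfolding has_vector_derivative_def complex_eq_iff Complex_eq
          by (auto intro!: derivative_eq_intros simp: scaleR_conv_of_real)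
        from field_vector_diff_chain_within[OF this has_field_derivative_at_within[OF prim_deriv]]
        show ?thesis using t by (simp add: o_def mult_ac)
      qed
      also have "\<i> * (f (Complex 0 t) * (u * Complex 0 t + v) ^ w) = (\<Sum>m\<le>w. c m * mellin (of_nat (m + 1)) t)"
      proof -
        have "exp (of_nat m * of_real (ln t)) = (of_real t ^ m :: complex)" for m
          using t by (simp add: exp_of_nat_mult exp_of_real)
        hence m: "mellin (of_nat (m + 1)) t = f (\<i> * of_real t) * of_real t ^ m" for m
          by (simp add: mellin_def)
        have "(u * Complex 0 t + v) ^ w = (\<Sum>m\<le>w. of_nat (w choose m) * (u * Complex 0 t) ^ m * v ^ (w - m))"
          by (rule binomial_ring)
        thus ?thesis unfolding m C sum_distrib_left
          by (simp add: c_def sum_distrib_left power_mult_distrib mult_ac)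
      qed
      finally show "((\<lambda>t. prim u v (Complex 0 t)) has_vector_derivative
          (\<Sum>m\<le>w. c m * mellin (of_nat (m + 1)) t)) (at t within {1 / real (Suc n)..real (Suc n)})" .
    qed
    ultimately show "I n = prim u v (Complex 0 (real (Suc n))) - prim u v (Complex 0 (1 / real (Suc n)))"
      by (rule has_integral_unique)
  qed
  moreover have "(\<lambda>n. prim u v (Complex 0 (real (Suc n))) - prim u v (Complex 0 (1 / real (Suc n))))
      \<longlonglongrightarrow> 0 - period_fun u v"
  proof (intro tendsto_diff)
    show "(\<lambda>n. prim u v (Complex 0 (real (Suc n)))) \<longlonglongrightarrow> 0"
      by (rule filterlim_compose[OF prim_tendsto_0]) real_asymp
    show "(\<lambda>n. prim u v (Complex 0 (1 / real (Suc n)))) \<longlonglongrightarrow> period_fun u v"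
      by (rule filterlim_compose[OF period_fun_limit]) real_asymp
  qed
  ultimately have "(\<Sum>m\<le>w. c m * mellin_int (of_nat (m + 1))) = 0 - period_fun u v"
    using LIMSEQ_unique by blast
  thus ?thesis by (simp add: c_def completed_L_eq)
qed

lemma period_fun_0_1: "period_fun 0 1 = - \<i> * completed_L f 1"
proof -
  have "(\<Sum>m\<le>w. of_nat (w choose m) * 0 ^ m * 1 ^ (w - m) * \<i> ^ (m + 1) * completed_L f (of_nat (m + 1))) =
      (\<Sum>m\<in>{0}. of_nat (w choose m) * 0 ^ m * 1 ^ (w - m) * \<i> ^ (m + 1) * completed_L f (of_nat (m + 1)))"
    by (rule sum.mono_neutral_right) auto
  thus ?thesis unfolding period_fun_sum by simp
qed

text \<open>Comparing coefficients of p^m in \<open>period_fun p 1 + period_fun 1 (- p) = 0\<close>,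
  valid for all p, gives the functional equation L(k - s) = (-1)^(k/2) L(s) at the odd integer s = m
  + 1.\<close>

lemma completed_L_reflect:
  assumes m: "m \<le> w" "even m"
  shows "(-1) ^ (m div 2) * completed_L f (of_nat (m + 1)) =
     - ((-1) ^ ((w - m) div 2) * completed_L f (of_nat (w - m + 1)))"
proof -
  let ?L = "\<lambda>m. completed_L f (of_nat (m + 1))"
  define a where "a m = of_nat (w choose m) * (\<i> ^ (m + 1) * ?L m + (-1) ^ m * \<i> ^ (w - m + 1) * ?L (w - m))" for m
  have "(\<Sum>m\<le>w. a m * p ^ m) = 0" for p :: complex
  proof -
    have "(\<Sum>m\<le>w. of_nat (w choose m) * 1 ^ m * (- p) ^ (w - m) * \<i> ^ (m + 1) * ?L m) =
        (\<Sum>m\<le>w. of_nat (w choose m) * (- p) ^ m * \<i> ^ (w - m + 1) * ?L (w - m))"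
      by (rule sum.reindex_bij_witness[where i = "\<lambda>m. w - m" and j = "\<lambda>m. w - m"])
         (auto simp: binomial_symmetric[symmetric])
    hence "(\<Sum>m\<le>w. a m * p ^ m) = - (period_fun p 1 + period_fun 1 (- p))"
      unfolding period_fun_sum
      by (simp add: a_def sum.distrib algebra_simps power_minus[of p])
    thus ?thesis by (simp add: period_fun_S)
  qed
  hence "a m = 0" using m(1) by (rule zero_polynom_imp_zero_coeffs)
  moreover have "of_nat (w choose m) \<noteq> (0 :: complex)" using m(1) by simp
  ultimately have eq: "\<i> ^ (m + 1) * ?L m + \<i> ^ (w - m + 1) * ?L (w - m) = 0"
    using m by (simp add: a_def)
  have i: "\<i> ^ (n + 1) = \<i> * (-1) ^ (n div 2)" if "even n" for n
    using that by (auto elim!: evenE simp: power_mult)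
  have "\<i> * ((-1) ^ (m div 2) * ?L m + (-1) ^ ((w - m) div 2) * ?L (w - m)) = 0"
    using eq m even_w unfolding i[OF m(2)] by (simp add: i algebra_simps)
  thus ?thesis by (simp add: add_eq_0_iff2 add_eq_0_iff)
qed

lemma period_coeff_antisym:
  assumes "(r, s) \<in> odd_pairs (w + 2)"
  shows "period_coeff (w + 2) f r s = - period_coeff (w + 2) f s r"
proof -
  have rs: "r + s = w + 2" "r \<ge> 3" "s \<ge> 3" "odd r" "odd s" using assms by (auto simp: odd_pairs_def)
  have e: "w - (s - 1) = r - 1" using rs by linarith
  have "(-1) ^ ((s - 1) div 2) * completed_L f (of_nat (s - 1 + 1)) =
     - ((-1) ^ ((r - 1) div 2) * completed_L f (of_nat (r - 1 + 1)))"
    using completed_L_reflect[of "s - 1"] rs unfolding e by simp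
  hence "of_nat (w choose (s - 1)) * ((-1) ^ ((s - 1) div 2) * completed_L f (of_nat s)) =
     of_nat (w choose (s - 1)) * (- ((-1) ^ ((r - 1) div 2) * completed_L f (of_nat r)))"
    using rs by simp
  moreover have "w choose (s - 1) = w choose (r - 1)"
    using binomial_symmetric[of "s - 1" w] rs e by simp
  ultimately show ?thesis by (simp add: period_coeff_def mult_ac)
qed

text \<open>Adding the value at - p keeps the even powers of p. The extreme terms m = 0 and m = w
  combine, by the functional equation, to a multiple of q^w - p^w, which the correction
  removes.\<close>

lemma reduced_period_eq:
  "reduced_period p q = - 2 * \<i> * period_poly_ev0 (w + 2) f (of_nat q) (of_nat p)"
\<comment> \<open>For w = 0 the two extreme terms coincide; everything vanishes because the
  functional equation at its centre gives L(1) = - L(1).\<close>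
proof (cases "w = 0")
  case True
  hence "completed_L f 1 = 0" using completed_L_reflect[of 0] by (simp add: eq_neg_iff_add_eq_0)
  moreover have "odd_pairs (w + 2) = {}" using True by (auto simp: odd_pairs_def)
  moreover have "period_fun u v = period_fun 0 1" for u v
    unfolding period_fun_sum using True by simp
  ultimately show ?thesis
    using period_fun_0_1 by (simp add: reduced_period_def period_poly_ev0_def)
next
  case False
  let ?L = "\<lambda>m. completed_L f (of_nat (m + 1))"
  define p' q' :: complex where "p' = of_nat p" and "q' = of_nat q"
  define t where "t m = of_nat (w choose m) * p' ^ m * q' ^ (w - m) * (-1) ^ (m div 2) * ?L m" for m
  have "period_fun p' q' + period_fun (- p') q' = - (\<Sum>m\<le>w. (if even m then 2 * \<i> * t m else 0))"
    unfolding period_fun_sum minus_add_distrib[symmetric] sum.distrib[symmetric]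
  proof (intro arg_cong[where f = uminus] sum.cong refl)
    fix m
    have "\<i> ^ (m + 1) = \<i> * (-1) ^ (m div 2)" if "even m"
      using that by (auto elim!: evenE simp: power_mult)
    thus "of_nat (w choose m) * p' ^ m * q' ^ (w - m) * \<i> ^ (m + 1) * ?L m +
          of_nat (w choose m) * (- p') ^ m * q' ^ (w - m) * \<i> ^ (m + 1) * ?L m =
          (if even m then 2 * \<i> * t m else 0)"
      by (cases "even m") (simp_all add: t_def mult_ac)
  qed
  also have "(\<Sum>m\<le>w. (if even m then 2 * \<i> * t m else 0)) = 2 * \<i> * (\<Sum>m\<in>{m. m \<le> w \<and> even m}. t m)"
    by (simp add: sum_distrib_left sum.If_cases) (intro sum.cong, auto)
  also have "{m. m \<le> w \<and> even m} = insert 0 (insert w {m. 2 \<le> m \<and> m \<le> w - 2 \<and> m < w \<and> even m})"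
    using even_w by (auto elim!: evenE)
  also have "(\<Sum>m\<in>\<dots>. t m) = t 0 + (t w + (\<Sum>m\<in>{m. 2 \<le> m \<and> m \<le> w - 2 \<and> m < w \<and> even m}. t m))"
    using False by (subst sum.insert; simp)+
  also have "(\<Sum>m\<in>{m. 2 \<le> m \<and> m \<le> w - 2 \<and> m < w \<and> even m}. t m) = period_poly_ev0 (w + 2) f q' p'"
    unfolding period_poly_ev0_def
    by (rule sum.reindex_bij_witness[where i = "\<lambda>(r, s). s - 1" and j = "\<lambda>m. (w + 1 - m, m + 1)"])
       (use even_w in \<open>auto simp: odd_pairs_def t_def period_coeff_def mult_ac Suc_diff_le\<close>)
  also have "t 0 = q' ^ w * completed_L f 1" by (simp add: t_def)
  also have "t w = p' ^ w * ((-1) ^ (w div 2) * ?L w)" by (simp add: t_def)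
  also have "(-1) ^ (w div 2) * ?L w = - completed_L f 1"
    using completed_L_reflect[of 0] by simp
  finally show ?thesis
    unfolding reduced_period_def p'_def[symmetric] q'_def[symmetric] period_fun_0_1
    by (simp add: algebra_simps)
qed

end

section \<open>Bernoulli sums and the main identity\<close>

text \<open>Multiply the geometric sum of exp (b X) by X/(1 - exp (- X)) and compare coefficients of
  X^r. The minus sign in the denominator, hence B_1 = +1/2, is what makes the sum end at n
  inclusive.\<close>

lemma faulhaber:
  assumes r: "r \<ge> 1"
  shows "(\<Sum>b=1..n. of_nat b ^ (r - 1) :: rat) =
    (\<Sum>j<r. of_nat (r choose j) * bernoulli j * of_nat n ^ (r - j)) / of_nat r"
proof -
  let ?g = "1 - fps_exp (-1) :: rat fps" and ?S = "(\<Sum>b=1..n. fps_exp (of_nat b)) :: rat fps"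
  let ?B = "fps_X / ?g"
  have g1: "fps_nth ?g 1 = 1" by simp
  hence g0: "?g \<noteq> 0" by (metis fps_zero_nth zero_neq_one)
  have "subdegree ?g = 1" by (rule subdegreeI) auto
  hence "?g dvd fps_X" using g0 by (simp add: fps_dvd_iff)
  hence B: "?B * ?g = fps_X" by simp
  have geom: "?S * ?g = fps_exp (of_nat n) - 1"
  proof (induction n)
    case (Suc n)
    have "fps_exp (of_nat (Suc n)) * fps_exp (-1) = (fps_exp (of_nat n) :: rat fps)"
      by (simp flip: fps_exp_add_mult)
    thus ?case using Suc by (simp add: algebra_simps)
  qed simp
  have "(fps_X * ?S) * ?g = (?B * ?g) * (fps_exp (of_nat n) - 1)"
    by (simp only: mult.assoc geom B)
  also have "\<dots> = (?B * (fps_exp (of_nat n) - 1)) * ?g"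
    by (simp only: mult_ac)
  finally have eq: "fps_X * ?S = ?B * (fps_exp (of_nat n) - 1)"
    by (simp only: mult_right_cancel[OF g0])
  have "(\<Sum>b=1..n. of_nat b ^ (r - 1) / fact (r - 1)) = fps_nth (fps_X * ?S) r"
    using r by (simp add: fps_sum_nth)
  also have "\<dots> = (\<Sum>j\<le>r. fps_nth ?B j * fps_nth (fps_exp (of_nat n) - 1) (r - j))"
    unfolding eq by (simp add: fps_mult_nth atLeast0AtMost)
  \<comment> \<open>The term j = r drops out because exp (n X) - 1 has no constant term.\<close>
  also have "\<dots> = (\<Sum>j<r. fps_nth ?B j * fps_nth (fps_exp (of_nat n) - 1) (r - j))"
    by (simp add: lessThan_Suc_atMost[symmetric])
  also have "\<dots> = (\<Sum>j<r. of_nat (r choose j) * bernoulli j * of_nat n ^ (r - j) / fact r)"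
  proof (rule sum.cong[OF refl])
    fix j assume "j \<in> {..<r}"
    hence j: "j < r" by simp
    have "fps_nth ?B j = bernoulli j / fact j" by (simp add: bernoulli_def)
    moreover have "of_nat (r choose j) = (fact r / (fact j * fact (r - j)) :: rat)"
      using j by (simp add: binomial_fact)
    ultimately show "fps_nth ?B j * fps_nth (fps_exp (of_nat n) - 1) (r - j) =
        of_nat (r choose j) * bernoulli j * of_nat n ^ (r - j) / fact r"
      using j by simp
  qed
  finally have "(\<Sum>b=1..n. of_nat b ^ (r - 1)) / fact (r - 1) =
      (\<Sum>j<r. of_nat (r choose j) * bernoulli j * of_nat n ^ (r - j)) / fact r"
    by (simp only: sum_divide_distrib)
  moreover have "(fact r :: rat) = of_nat r * fact (r - 1)" using r by (simp add: fact_reduce)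
  ultimately show ?thesis using r by (simp add: field_simps)
qed

lemma faulhaber_complex:
  assumes "r \<ge> 1"
  shows "(\<Sum>b=1..n. of_nat b ^ (r - 1) :: complex) =
    (\<Sum>j<r. of_nat (r choose j) * of_rat (bernoulli j) * of_nat n ^ (r - j)) / of_nat r"
  using arg_cong[OF faulhaber[OF assms, of n], of "of_rat :: rat \<Rightarrow> complex"]
  by (simp add: of_rat_sum of_rat_divide of_rat_mult of_rat_power)

text \<open>The weight 1/2 at D/2 is what remains of the boundary sum in \<open>manin_sum\<close>
  after division by 2: there each b < D/2 counts twice and the midpoint once.\<close>

definition half_power_sum :: "nat \<Rightarrow> nat \<Rightarrow> complex" where
  "half_power_sum r D = (\<Sum>b | 0 < b \<and> 2 * b < D. of_nat b ^ (r - 1))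
     + (if even D then of_nat (D div 2) ^ (r - 1) / 2 else 0)"

text \<open>Apply Faulhaber with n = D/2 or n = (D - 1)/2. For even D it counts the midpoint fully,
  and the surplus D^(r-1)/2^r yields the even zeta term. For odd D, expanding (D - 1)^(r-j) gives
  the same terms at l = 0 and the odd zeta terms for l >= 1. The leading term is split off because
  it belongs to \<open>lambda_f\<close>.\<close>

lemma half_power_sum_eq:
  assumes r: "r \<ge> 1" and D: "D > 0"
  shows "half_power_sum r D = of_nat D ^ r / (of_nat r * 2 ^ r)
    + (\<Sum>j=1..r-1. of_nat (r choose j) * of_rat (bernoulli j) / (of_nat r * 2 ^ (r - j)) * of_nat D ^ (r - j))
    - (if even D then of_nat D ^ (r - 1) / 2 ^ r else 0)
    + (if odd D then (\<Sum>(j, l)\<in>{(j, l). j \<le> r - 1 \<and> 1 \<le> l \<and> l \<le> r - j}.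
         of_nat (r choose j) * of_nat ((r - j) choose l) * (-1) ^ l * of_rat (bernoulli j)
           / (of_nat r * 2 ^ (r - j)) * of_nat D ^ (r - j - l)) else 0)"
proof -
  define a :: "nat \<Rightarrow> complex" where
    "a j = of_nat (r choose j) * of_rat (bernoulli j) / (of_nat r * 2 ^ (r - j))" for j
  have B0: "bernoulli 0 = 1"
  proof -
    have "(1::rat) = bernoulli 0" using faulhaber[of 1 1] by simp
    thus ?thesis by simp
  qed
  have split0: "(\<Sum>j<r. a j * of_nat D ^ (r - j)) =
      of_nat D ^ r / (of_nat r * 2 ^ r) + (\<Sum>j=1..r-1. a j * of_nat D ^ (r - j))"
  proof -
    have "{..<r} = insert 0 {1..r-1}" using r by auto
    thus ?thesis by (simp add: a_def B0)
  qed
  show ?thesis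
  proof (cases "even D")
    case True
    then obtain n where n: "D = 2 * n" by (rule evenE)
    have n0: "n > 0" using D n by simp
    have "{b. 0 < b \<and> 2 * b < D} = {1..n} - {n}" using n by auto
    hence "half_power_sum r D = (\<Sum>b=1..n. of_nat b ^ (r - 1)) - of_nat n ^ (r - 1) / 2"
      using n0 n by (simp add: half_power_sum_def sum_diff1)
    also have "(\<Sum>b=1..n. of_nat b ^ (r - 1)) = (\<Sum>j<r. a j * of_nat D ^ (r - j))"
      unfolding faulhaber_complex[OF r] n a_def
      by (simp add: sum_divide_distrib power_mult_distrib mult_ac)
    also have "of_nat n ^ (r - 1) / 2 = (of_nat D ^ (r - 1) / 2 ^ r :: complex)"
    proof -
      have "(2 :: complex) ^ r = 2 * 2 ^ (r - 1)" using r by (cases r) auto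
      thus ?thesis by (simp add: n power_mult_distrib)
    qed
    finally show ?thesis using True unfolding split0 by (simp add: a_def)
  next
    case False
    then obtain n where n: "D = 2 * n + 1" by (rule oddE)
    have "{b. 0 < b \<and> 2 * b < D} = {1..n}" using n by auto
    hence "half_power_sum r D = (\<Sum>b=1..n. of_nat b ^ (r - 1))"
      using False by (simp add: half_power_sum_def)
    also have "\<dots> = (\<Sum>j<r. a j * of_nat (2 * n) ^ (r - j))"
      unfolding faulhaber_complex[OF r] a_def
      by (simp add: sum_divide_distrib power_mult_distrib mult_ac)
    also have "\<dots> = (\<Sum>j<r. a j * of_nat D ^ (r - j) +
        (\<Sum>l=1..r-j. a j * of_nat ((r - j) choose l) * (-1) ^ l * of_nat D ^ (r - j - l)))"
    proof (rule sum.cong[OF refl])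
      fix j
      have "(of_nat (2 * n) :: complex) ^ (r - j) = (-1 + of_nat D) ^ (r - j)" by (simp add: n)
      also have "\<dots> = (\<Sum>l\<le>r-j. of_nat ((r - j) choose l) * (-1) ^ l * of_nat D ^ (r - j - l))"
        by (rule binomial_ring)
      also have "{..r-j} = insert 0 {1..r-j}" by auto
      also have "(\<Sum>l\<in>\<dots>. of_nat ((r - j) choose l) * (-1) ^ l * of_nat D ^ (r - j - l)) =
          of_nat D ^ (r - j) + (\<Sum>l=1..r-j. of_nat ((r - j) choose l) * (-1) ^ l * of_nat D ^ (r - j - l) :: complex)"
        by simp
      finally show "a j * of_nat (2 * n) ^ (r - j) = a j * of_nat D ^ (r - j) +
        (\<Sum>l=1..r-j. a j * of_nat ((r - j) choose l) * (-1) ^ l * of_nat D ^ (r - j - l))"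
        by (simp add: algebra_simps sum_distrib_left)
    qed
    also have "\<dots> = (\<Sum>j<r. a j * of_nat D ^ (r - j)) +
        (\<Sum>j<r. \<Sum>l=1..r-j. a j * of_nat ((r - j) choose l) * (-1) ^ l * of_nat D ^ (r - j - l))"
      by (rule sum.distrib)
    also have "(\<Sum>j<r. \<Sum>l=1..r-j. a j * of_nat ((r - j) choose l) * (-1) ^ l * of_nat D ^ (r - j - l)) =
        (\<Sum>(j, l)\<in>Sigma {..<r} (\<lambda>j. {1..r-j}). a j * of_nat ((r - j) choose l) * (-1) ^ l * of_nat D ^ (r - j - l))"
      by (rule sum.Sigma) auto
    also have "Sigma {..<r} (\<lambda>j. {1..r-j}) = {(j, l). j \<le> r - 1 \<and> 1 \<le> l \<and> l \<le> r - j}"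
      using r by auto
    finally show ?thesis using False unfolding split0 by (simp add: a_def mult_ac)
  qed
qed

section \<open>Coefficients of the correction terms and the final comparison\<close>

lemma of_rat_fact: "of_rat (fact n) = (fact n :: 'a::field_char_0)"
  by (metis of_nat_fact of_rat_of_nat_eq)

lemma zeta_q_complex_nth:
  assumes "k \<ge> 1" "N > 0"
  shows "fps_nth (fps_of_rat (zeta_q k)) N = (\<Sum>d | d dvd N. of_nat d ^ (k - 1) / fact (k - 1))"
  using assms by (simp add: fps_of_rat_def zeta_q_nth of_rat_sum of_rat_divide of_rat_power of_rat_fact)

lemma zeta_q_even_complex_nth:
  assumes "N > 0"
  shows "fps_nth (fps_of_rat (zeta_q_even k)) N =
    (\<Sum>d | d dvd N. if even d then of_nat d ^ (k - 1) / fact (k - 1) else 0)"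
proof -
  have "{d. d dvd N} \<inter> {d. even d} = {d. d dvd N \<and> even d}" by auto
  thus ?thesis using assms
    by (simp add: fps_of_rat_def zeta_q_even_nth of_rat_sum of_rat_divide of_rat_power of_rat_fact sum.If_cases)
qed

lemma zeta_q_odd_complex_nth:
  assumes "N > 0"
  shows "fps_nth (fps_of_rat (zeta_q_odd k)) N =
    (\<Sum>d | d dvd N. if odd d then of_nat d ^ (k - 1) / fact (k - 1) else 0)"
proof -
  have "{d. d dvd N} \<inter> {d. odd d} = {d. d dvd N \<and> odd d}" by auto
  thus ?thesis using assms
    by (simp add: fps_of_rat_def zeta_q_odd_nth of_rat_sum of_rat_divide of_rat_power of_rat_fact sum.If_cases)
qed

lemma zeta_q_hat_complex_nth:
  assumes "r \<ge> 1" "s \<ge> 1"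
  shows "fps_nth (fps_of_rat (zeta_q_hat r s)) N =
    (\<Sum>(m, n, D, d)\<in>manin_quads N.
       of_nat d ^ (r - 1) / fact (r - 1) * (of_nat (D - d) ^ (s - 1) / fact (s - 1)))"
  using assms
  by (simp add: fps_of_rat_def zeta_q_hat_nth of_rat_sum of_rat_mult of_rat_divide of_rat_power of_rat_fact case_prod_unfold)

lemma manin_quads_0 [simp]: "manin_quads 0 = {}"
  by (auto simp: manin_quads_def)

lemma fps_nth_0_zeta:
  "k \<ge> 1 \<Longrightarrow> fps_nth (fps_of_rat (zeta_q k)) 0 = 0"
  "fps_nth (fps_of_rat (zeta_q_even k)) 0 = 0"
  "fps_nth (fps_of_rat (zeta_q_odd k)) 0 = 0"
  "r \<ge> 1 \<Longrightarrow> s \<ge> 1 \<Longrightarrow> fps_nth (fps_of_rat (zeta_q_hat r s)) 0 = 0"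
  by (auto simp: fps_of_rat_def zeta_q_nth zeta_q_even_nth zeta_q_odd_nth zeta_q_hat_nth)

text \<open>The factorials in \<open>R_f\<close> cancel those in the single zeta series, and k - j -
  1 = (s - 1) + (r - j) splits off D^(s-1). What remains is the expansion in
  \<open>half_power_sum_eq\<close> without its leading term.\<close>

lemma R_f_nth:
  "fact w * fps_nth (R_f (w + 2) f) N = (if N > 0 then
    (\<Sum>D | D dvd N. \<Sum>(r, s)\<in>odd_pairs (w + 2). period_coeff (w + 2) f r s *
        (of_nat D ^ (s - 1) * (half_power_sum r D - of_nat D ^ r / (of_nat r * 2 ^ r)))) else 0)"
proof -
  let ?k = "w + 2"
  define JL where "JL r = {(j, l). j \<le> r - 1 \<and> 1 \<le> l \<and> l \<le> r - j}" for r :: nat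
  define A where "A r = (\<Sum>j=1..r-1. of_nat (r choose j) * of_rat (bernoulli j) * fact (?k - j - 1)
                       / (of_nat r * 2 ^ (r - j) * fact (?k - 2)) * fps_nth (fps_of_rat (zeta_q (?k - j))) N)" for r
  define B where "B r = 1 / 2 ^ r * fps_nth (fps_of_rat (zeta_q_even (?k - 1))) N" for r :: nat
  define C where "C r = (\<Sum>(j, l)\<in>JL r. of_nat (r choose j) * of_nat ((r - j) choose l)
                       * (-1) ^ l * of_rat (bernoulli j) * fact (?k - j - l - 1)
                       / (of_nat r * 2 ^ (r - j) * fact (?k - 2)) * fps_nth (fps_of_rat (zeta_q_odd (?k - j - l))) N)" for r
  have "fps_nth (R_f ?k f) N = (\<Sum>(r, s)\<in>odd_pairs ?k. period_coeff ?k f r s * (A r - B r))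
      + (\<Sum>(r, s)\<in>odd_pairs ?k. period_coeff ?k f r s * C r)"
    unfolding R_f_def A_def B_def C_def JL_def
    by (simp add: fps_sum_nth case_prod_unfold)
  also have "\<dots> = (\<Sum>(r, s)\<in>odd_pairs ?k. period_coeff ?k f r s * (A r - B r + C r))"
    by (simp add: sum.distrib[symmetric] case_prod_unfold distrib_left)
  finally have R: "fps_nth (R_f ?k f) N = (\<Sum>(r, s)\<in>odd_pairs ?k. period_coeff ?k f r s * (A r - B r + C r))" .
  show ?thesis
  proof (cases "N > 0")
    case False
    have "A r - B r + C r = 0" if "(r, s) \<in> odd_pairs ?k" for r s
    proof -
      have rs: "r + s = ?k" "s \<ge> 3" "r \<ge> 3" using that by (auto simp: odd_pairs_def)
      have "fps_nth (fps_of_rat (zeta_q (?k - j))) N = 0" if "j \<in> {1..r-1}" for j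
        using that rs False by (auto intro: fps_nth_0_zeta)
      hence "A r = 0" unfolding A_def by (intro sum.neutral) auto
      thus ?thesis using False by (simp add: B_def C_def fps_nth_0_zeta)
    qed
    hence "fps_nth (R_f ?k f) N = 0" unfolding R by (intro sum.neutral) auto
    thus ?thesis using False by simp
  next
    case N: True
    have Dpos: "D > 0" if "D dvd N" for D using that N by (intro Nat.gr0I) auto
    have ABC: "fact w * (A r - B r + C r) =
        (\<Sum>D | D dvd N. of_nat D ^ (s - 1) * (half_power_sum r D - of_nat D ^ r / (of_nat r * 2 ^ r)))"
      if rs: "(r, s) \<in> odd_pairs ?k" for r s
    proof -
      have r: "r \<ge> 1" "s \<ge> 1" "r + s = ?k" using rs by (auto simp: odd_pairs_def)
      have A: "fact w * A r = (\<Sum>D | D dvd N. of_nat D ^ (s - 1) *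
          (\<Sum>j=1..r-1. of_nat (r choose j) * of_rat (bernoulli j) / (of_nat r * 2 ^ (r - j)) * of_nat D ^ (r - j)))"
        unfolding A_def sum_distrib_left
      proof (subst sum.swap, rule sum.cong[OF refl])
        fix j assume j: "j \<in> {1..r-1}"
        have e: "?k - j - 1 = (s - 1) + (r - j)" "?k - j \<ge> 1" using j r by auto
        show "fact w * (of_nat (r choose j) * of_rat (bernoulli j) * fact (?k - j - 1)
                 / (of_nat r * 2 ^ (r - j) * fact (?k - 2)) * fps_nth (fps_of_rat (zeta_q (?k - j))) N) =
            (\<Sum>D | D dvd N. of_nat D ^ (s - 1) *
               (of_nat (r choose j) * of_rat (bernoulli j) / (of_nat r * 2 ^ (r - j)) * of_nat D ^ (r - j)))"
        proof -
          have "(of_nat D :: complex) ^ (?k - j - 1) = of_nat D ^ (s - 1) * of_nat D ^ (r - j)" for D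
            unfolding e(1) by (rule power_add)
          thus ?thesis
            unfolding zeta_q_complex_nth[OF e(2) N] sum_distrib_left
            by (intro sum.cong refl) (simp add: mult_ac)
        qed
      qed
      have B: "fact w * B r = (\<Sum>D | D dvd N. of_nat D ^ (s - 1) * (if even D then of_nat D ^ (r - 1) / 2 ^ r else 0))"
        unfolding B_def zeta_q_even_complex_nth[OF N] sum_distrib_left
      proof (rule sum.cong[OF refl])
        fix D
        have "w = (s - 1) + (r - 1)" using r by simp
        hence "of_nat D ^ w = (of_nat D ^ (s - 1) * of_nat D ^ (r - 1) :: complex)" by (metis power_add)
        thus "fact w * (1 / 2 ^ r * (if even D then of_nat D ^ (?k - 1 - 1) / fact (?k - 1 - 1) else 0)) =
            of_nat D ^ (s - 1) * (if even D then of_nat D ^ (r - 1) / 2 ^ r else (0 :: complex))"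
          by simp
      qed
      have C: "fact w * C r = (\<Sum>D | D dvd N. of_nat D ^ (s - 1) *
          (if odd D then (\<Sum>(j, l)\<in>JL r. of_nat (r choose j) * of_nat ((r - j) choose l) * (-1) ^ l * of_rat (bernoulli j)
             / (of_nat r * 2 ^ (r - j)) * of_nat D ^ (r - j - l)) else 0))"
      proof -
        have "(\<Sum>D | D dvd N. of_nat D ^ (s - 1) *
          (if odd D then (\<Sum>(j, l)\<in>JL r. of_nat (r choose j) * of_nat ((r - j) choose l) * (-1) ^ l * of_rat (bernoulli j)
             / (of_nat r * 2 ^ (r - j)) * of_nat D ^ (r - j - l)) else 0)) =
          (\<Sum>D | D dvd N. \<Sum>(j, l)\<in>JL r. of_nat D ^ (s - 1) * (if odd D then
            of_nat (r choose j) * of_nat ((r - j) choose l) * (-1) ^ l * of_rat (bernoulli j)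
             / (of_nat r * 2 ^ (r - j)) * of_nat D ^ (r - j - l) else 0))"
          by (intro sum.cong refl) (simp add: sum_distrib_left case_prod_unfold)
        also have "\<dots> = (\<Sum>x\<in>JL r. \<Sum>D | D dvd N. case x of (j, l) \<Rightarrow> of_nat D ^ (s - 1) * (if odd D then
            of_nat (r choose j) * of_nat ((r - j) choose l) * (-1) ^ l * of_rat (bernoulli j)
             / (of_nat r * 2 ^ (r - j)) * of_nat D ^ (r - j - l) else 0))"
          by (rule sum.swap)
        also have "\<dots> = fact w * C r"
          unfolding C_def sum_distrib_left
        proof (rule sum.cong[OF refl])
          fix x assume "x \<in> JL r"
          then obtain j l where x: "x = (j, l)" "j \<le> r - 1" "1 \<le> l" "l \<le> r - j" by (auto simp: JL_def)
          have e: "?k - j - l - 1 = (s - 1) + (r - j - l)" using x r by auto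
          show "(\<Sum>D | D dvd N. case x of (j, l) \<Rightarrow> of_nat D ^ (s - 1) * (if odd D then
              of_nat (r choose j) * of_nat ((r - j) choose l) * (-1) ^ l * of_rat (bernoulli j)
               / (of_nat r * 2 ^ (r - j)) * of_nat D ^ (r - j - l) else 0)) =
            fact w * (case x of (j, l) \<Rightarrow> of_nat (r choose j) * of_nat ((r - j) choose l)
                         * (-1) ^ l * of_rat (bernoulli j) * fact (?k - j - l - 1)
                         / (of_nat r * 2 ^ (r - j) * fact (?k - 2)) * fps_nth (fps_of_rat (zeta_q_odd (?k - j - l))) N)"
          proof -
            have "(of_nat D :: complex) ^ (?k - j - l - 1) = of_nat D ^ (s - 1) * of_nat D ^ (r - j - l)" for D
              unfolding e by (rule power_add)
            thus ?thesis
              unfolding x(1) prod.case zeta_q_odd_complex_nth[OF N] sum_distrib_left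
              by (intro sum.cong refl) (simp add: mult_ac)
          qed
        qed
        finally show ?thesis by simp
      qed
      have "fact w * (A r - B r + C r) = fact w * A r - fact w * B r + fact w * C r"
        by (simp add: algebra_simps)
      also have "\<dots> = (\<Sum>D | D dvd N. of_nat D ^ (s - 1) * (half_power_sum r D - of_nat D ^ r / (of_nat r * 2 ^ r)))"
        unfolding A B C sum_subtractf[symmetric] sum.distrib[symmetric]
      proof (rule sum.cong[OF refl])
        fix D assume "D \<in> {D. D dvd N}"
        hence "D > 0" using Dpos by simp
        from half_power_sum_eq[OF r(1) this]
        show "of_nat D ^ (s - 1) * (\<Sum>j=1..r-1. of_nat (r choose j) * of_rat (bernoulli j) / (of_nat r * 2 ^ (r - j)) * of_nat D ^ (r - j))
            - of_nat D ^ (s - 1) * (if even D then of_nat D ^ (r - 1) / 2 ^ r else 0)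
            + of_nat D ^ (s - 1) * (if odd D then (\<Sum>(j, l)\<in>JL r. of_nat (r choose j) * of_nat ((r - j) choose l) * (-1) ^ l * of_rat (bernoulli j)
             / (of_nat r * 2 ^ (r - j)) * of_nat D ^ (r - j - l)) else 0) =
            of_nat D ^ (s - 1) * (half_power_sum r D - of_nat D ^ r / (of_nat r * 2 ^ r))"
          unfolding JL_def[symmetric] by (simp only: right_diff_distrib distrib_left) simp
      qed
      finally show ?thesis .
    qed
    have "fact w * fps_nth (R_f ?k f) N = (\<Sum>(r, s)\<in>odd_pairs ?k. period_coeff ?k f r s * (fact w * (A r - B r + C r)))"
      unfolding R by (simp add: sum_distrib_left case_prod_unfold mult_ac)
    also have "\<dots> = (\<Sum>x\<in>odd_pairs ?k. \<Sum>D | D dvd N. case x of (r, s) \<Rightarrow> period_coeff ?k f r s *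
          (of_nat D ^ (s - 1) * (half_power_sum r D - of_nat D ^ r / (of_nat r * 2 ^ r))))"
    proof (rule sum.cong[OF refl])
      fix x assume x: "x \<in> odd_pairs ?k"
      obtain r s where rs: "x = (r, s)" by (cases x)
      show "(case x of (r, s) \<Rightarrow> period_coeff ?k f r s * (fact w * (A r - B r + C r))) =
        (\<Sum>D | D dvd N. case x of (r, s) \<Rightarrow> period_coeff ?k f r s *
          (of_nat D ^ (s - 1) * (half_power_sum r D - of_nat D ^ r / (of_nat r * 2 ^ r))))"
        using ABC[of r s] x unfolding rs prod.case by (simp add: sum_distrib_left)
    qed
    also have "\<dots> = (\<Sum>D | D dvd N. \<Sum>(r, s)\<in>odd_pairs ?k. period_coeff ?k f r s *
          (of_nat D ^ (s - 1) * (half_power_sum r D - of_nat D ^ r / (of_nat r * 2 ^ r))))"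
      by (rule sum.swap)
    finally show ?thesis using N by simp
  qed
qed

text \<open>Antisymmetry of the coefficients exchanges r and s at the cost of a sign. Then b carries
  the exponent r - 1 and D carries s - 1, the pairing that \<open>R_f\<close> uses.\<close>

lemma (in cusp_form) period_poly_half_sum:
  "(\<Sum>b | 0 < b \<and> 2 * b < D. period_poly_ev0 (w + 2) f (of_nat D) (of_nat b))
     + (if even D then period_poly_ev0 (w + 2) f (of_nat D) (of_nat (D div 2)) / 2 else 0) =
   - (\<Sum>(r, s)\<in>odd_pairs (w + 2). period_coeff (w + 2) f r s * (of_nat D ^ (s - 1) * half_power_sum r D))"
proof -
  let ?O = "odd_pairs (w + 2)" and ?c = "period_coeff (w + 2) f"
  have P: "period_poly_ev0 (w + 2) f X Y = - (\<Sum>(r, s)\<in>?O. ?c r s * (X ^ (s - 1) * Y ^ (r - 1)))" for X Y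
  proof -
    have "period_poly_ev0 (w + 2) f X Y = (\<Sum>(r, s)\<in>?O. ?c s r * X ^ (s - 1) * Y ^ (r - 1))"
      unfolding period_poly_ev0_def
      by (rule sum.reindex_bij_witness[where i = prod.swap and j = prod.swap]) (auto simp: odd_pairs_def)
    also have "\<dots> = (\<Sum>(r, s)\<in>?O. - (?c r s * (X ^ (s - 1) * Y ^ (r - 1))))"
    proof (rule sum.cong[OF refl])
      fix x assume x: "x \<in> ?O"
      obtain r s where rs: "x = (r, s)" by (cases x)
      show "(case x of (r, s) \<Rightarrow> ?c s r * X ^ (s - 1) * Y ^ (r - 1)) =
          (case x of (r, s) \<Rightarrow> - (?c r s * (X ^ (s - 1) * Y ^ (r - 1))))"
        using period_coeff_antisym[of r s] x unfolding rs prod.case by simp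
    qed
    finally show ?thesis by (simp add: sum_negf case_prod_unfold)
  qed
  have "(\<Sum>b | 0 < b \<and> 2 * b < D. \<Sum>(r, s)\<in>?O. ?c r s * (of_nat D ^ (s - 1) * of_nat b ^ (r - 1))) =
      (\<Sum>x\<in>?O. \<Sum>b | 0 < b \<and> 2 * b < D. case x of (r, s) \<Rightarrow> ?c r s * (of_nat D ^ (s - 1) * of_nat b ^ (r - 1)))"
    by (rule sum.swap)
  hence 1: "(\<Sum>b | 0 < b \<and> 2 * b < D. period_poly_ev0 (w + 2) f (of_nat D) (of_nat b)) =
      - (\<Sum>(r, s)\<in>?O. ?c r s * (of_nat D ^ (s - 1) * (\<Sum>b | 0 < b \<and> 2 * b < D. of_nat b ^ (r - 1))))"
    unfolding P sum_negf by (simp add: sum_distrib_left case_prod_unfold)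
  have 2: "(if even D then period_poly_ev0 (w + 2) f (of_nat D) (of_nat (D div 2)) / 2 else 0) =
      - (\<Sum>(r, s)\<in>?O. ?c r s * (of_nat D ^ (s - 1) * (if even D then of_nat (D div 2) ^ (r - 1) / 2 else 0)))"
    unfolding P by (simp add: sum_divide_distrib case_prod_unfold)
  show ?thesis unfolding 1 2 minus_add_distrib[symmetric] sum.distrib[symmetric]
    by (simp add: half_power_sum_def case_prod_unfold distrib_left)
qed

text \<open>Dividing Manin's formula by - 4 \<i> removes the factor 2 of \<open>manin_sum\<close>
  and the - 2 \<i> of \<open>reduced_period_eq\<close>; the boundary sum is then given by
  \<open>period_poly_half_sum\<close>.\<close>

lemma (in cusp_eigenform) coefficient_period_formula:
  assumes N: "N > 0"
  shows "completed_L f 1 / 2 * fps_nth F N = completed_L f 1 / 2 * (\<Sum>d | d dvd N. of_nat d ^ (w + 1))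
    + (\<Sum>(m, n, D, d)\<in>manin_quads N. period_poly_ev0 (w + 2) f (of_nat D) (of_nat d))
    - (\<Sum>D | D dvd N. \<Sum>(r, s)\<in>odd_pairs (w + 2). period_coeff (w + 2) f r s * (of_nat D ^ (s - 1) * half_power_sum r D))"
proof -
  let ?P = "\<lambda>D b. period_poly_ev0 (w + 2) f (of_nat D) (of_nat b)"
  let ?\<sigma> = "(\<Sum>d | d dvd N. of_nat d ^ (w + 1)) :: complex"
  define Q where "Q = (\<Sum>(m, n, D, d)\<in>manin_quads N. ?P D d)"
  define W where "W = (\<Sum>D | D dvd N. (\<Sum>b | 0 < b \<and> 2 * b < D. ?P D b) + (if even D then ?P D (D div 2) / 2 else 0))"
  have "2 * (- \<i> * completed_L f 1) * (fps_nth F N - ?\<sigma>) =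
    2 * (\<Sum>(m, n, D, d)\<in>manin_quads N. - 2 * \<i> * ?P D d) +
    (\<Sum>D | D dvd N. 2 * (\<Sum>b | 0 < b \<and> 2 * b < D. - 2 * \<i> * ?P D b) +
       (if even D then - 2 * \<i> * ?P D (D div 2) else 0))"
    using manin_coefficient_formula[of N] N unfolding period_fun_0_1 reduced_period_eq by simp
  also have "(\<Sum>(m, n, D, d)\<in>manin_quads N. - 2 * \<i> * ?P D d) = - 2 * \<i> * Q"
    by (simp add: Q_def sum_distrib_left case_prod_unfold)
  also have "(\<Sum>D | D dvd N. 2 * (\<Sum>b | 0 < b \<and> 2 * b < D. - 2 * \<i> * ?P D b) +
       (if even D then - 2 * \<i> * ?P D (D div 2) else 0)) = - 4 * \<i> * W"
    unfolding W_def sum_distrib_left[of "- 4 * \<i>"]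
    by (intro sum.cong refl) (simp add: sum_distrib_left[symmetric] distrib_left sum_negf)
  finally have "- 4 * \<i> * (completed_L f 1 / 2 * (fps_nth F N - ?\<sigma>)) = - 4 * \<i> * (Q + W)"
    by (simp add: algebra_simps)
  hence "completed_L f 1 / 2 * (fps_nth F N - ?\<sigma>) = Q + W"
    by (simp only: mult_cancel_left) simp
  moreover have "W = - (\<Sum>D | D dvd N. \<Sum>(r, s)\<in>odd_pairs (w + 2). period_coeff (w + 2) f r s * (of_nat D ^ (s - 1) * half_power_sum r D))"
    unfolding W_def by (subst sum_negf[symmetric]) (intro sum.cong refl period_poly_half_sum)
  ultimately show ?thesis by (simp add: Q_def algebra_simps)
qed

text \<open>The double series involve only r, s >= 2, so the coefficients with r = 1 or s = 1 have
  to vanish; this is seen by setting X = 0 and Y = 0. For w = 0 these two indices coincide, whence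
  the separate case.\<close>

lemma (in cusp_form) inner_period_sum:
  fixes q :: "nat \<Rightarrow> nat \<Rightarrow> complex"
  assumes q: "\<And>X Y. period_poly_ev0 (w + 2) f (X + Y) X =
           (\<Sum>(r, s)\<in>{(r, s). r + s = w + 2 \<and> r \<ge> 1 \<and> s \<ge> 1}.
              of_nat (w choose (r - 1)) * q r s * X ^ (r - 1) * Y ^ (s - 1))"
  shows "(\<Sum>(r, s)\<in>{(r, s). r + s = w + 2 \<and> r \<ge> 2 \<and> s \<ge> 2}.
              of_nat (w choose (r - 1)) * q r s * X ^ (r - 1) * Y ^ (s - 1)) = period_poly_ev0 (w + 2) f (X + Y) X"
proof (cases "w = 0")
  case True
  hence O: "odd_pairs (w + 2) = {}" by (auto simp: odd_pairs_def)
  have I: "{(r, s). r + s = w + 2 \<and> r \<ge> 2 \<and> s \<ge> 2} = ({} :: (nat \<times> nat) set)" using True by auto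
  show ?thesis unfolding I period_poly_ev0_def O by simp
next
  case False
  let ?I = "{(r, s). r + s = w + 2 \<and> r \<ge> 2 \<and> s \<ge> 2} :: (nat \<times> nat) set"
  let ?t = "\<lambda>X Y (r, s). of_nat (w choose (r - 1)) * q r s * X ^ (r - 1) * Y ^ (s - 1) :: complex"
  have fin: "finite ?I" by (rule finite_subset[of _ "{..w+2} \<times> {..w+2}"]) auto
  have "{(r, s). r + s = w + 2 \<and> r \<ge> 1 \<and> s \<ge> 1} = insert (1, w + 1) (insert (w + 1, 1) ?I)" by auto
  hence P: "period_poly_ev0 (w + 2) f (X + Y) X = ?t X Y (1, w + 1) + (?t X Y (w + 1, 1) + sum (?t X Y) ?I)" for X Y
    unfolding q using False fin by (simp only:) (subst sum.insert, auto)+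
  \<comment> \<open>At X = 0 only r = 1 survives on the right, and every monomial of the polynomial
    contains its second argument.\<close>
  have "period_poly_ev0 (w + 2) f (0 + 1) 0 = 0"
    unfolding period_poly_ev0_def by (intro sum.neutral) (auto simp: odd_pairs_def)
  moreover have "sum (?t 0 1) ?I = 0" by (intro sum.neutral) auto
  ultimately have q1: "q 1 (w + 1) = 0" unfolding P using False by (simp add: zero_power)
  \<comment> \<open>At Y = 0 only s = 1 survives, and the value at (1, 1) is the sum of all
    coefficients, zero by antisymmetry.\<close>
  have "period_poly_ev0 (w + 2) f (1 + 0) 1 = (\<Sum>(r, s)\<in>odd_pairs (w + 2). period_coeff (w + 2) f r s)"
    by (simp add: period_poly_ev0_def)
  also have "\<dots> = (\<Sum>(r, s)\<in>odd_pairs (w + 2). period_coeff (w + 2) f s r)"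
    by (rule sum.reindex_bij_witness[where i = prod.swap and j = prod.swap]) (auto simp: odd_pairs_def)
  also have "\<dots> = (\<Sum>(r, s)\<in>odd_pairs (w + 2). - period_coeff (w + 2) f r s)"
  proof (rule sum.cong[OF refl])
    fix x assume x: "x \<in> odd_pairs (w + 2)"
    obtain r s where rs: "x = (r, s)" by (cases x)
    show "(case x of (r, s) \<Rightarrow> period_coeff (w + 2) f s r) = (case x of (r, s) \<Rightarrow> - period_coeff (w + 2) f r s)"
      using period_coeff_antisym[of r s] x unfolding rs prod.case by simp
  qed
  also have "\<dots> = - (\<Sum>(r, s)\<in>odd_pairs (w + 2). period_coeff (w + 2) f r s)"
    by (simp add: sum_negf case_prod_unfold)
  also have "(\<Sum>(r, s)\<in>odd_pairs (w + 2). period_coeff (w + 2) f r s) = period_poly_ev0 (w + 2) f (1 + 0) 1"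
    by (simp add: period_poly_ev0_def)
  finally have "period_poly_ev0 (w + 2) f (1 + 0) 1 = 0" by simp
  moreover have "sum (?t 1 0) ?I = 0" by (intro sum.neutral) auto
  ultimately have q2: "q (w + 1) 1 = 0" unfolding P using False by (simp add: zero_power)
  show ?thesis unfolding P using q1 q2 by simp
qed

text \<open>After multiplication by w! the factorials of the two zeta factors form the binomial
  coefficient, so the sum over r, s is P(X + Y, X) at X = d, Y = D - d, that is P(D, d).\<close>

theorem (in cusp_eigenform) eigenform_double_zeta_formula:
  fixes q :: "nat \<Rightarrow> nat \<Rightarrow> complex"
  assumes q: "\<And>X Y. period_poly_ev0 (w + 2) f (X + Y) X =
           (\<Sum>(r, s)\<in>{(r, s). r + s = w + 2 \<and> r \<ge> 1 \<and> s \<ge> 1}.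
              of_nat (w choose (r - 1)) * q r s * X ^ (r - 1) * Y ^ (s - 1))"
  shows "fps_const (completed_L f 1 / (2 * fact w)) * q_expansion f =
           (\<Sum>(r, s)\<in>{(r, s). r + s = w + 2 \<and> r \<ge> 2 \<and> s \<ge> 2}.
              fps_const (q r s) * fps_of_rat (zeta_q_hat r s))
           - fps_const (lambda_f (w + 2) f) * fps_of_rat (zeta_q (w + 2))
           - R_f (w + 2) f"
    (is "?lhs = (\<Sum>(r, s)\<in>?I. ?h r s) - ?z - _")
proof (rule fps_ext)
  fix N
  show "fps_nth ?lhs N = fps_nth ((\<Sum>(r, s)\<in>?I. ?h r s) - ?z - R_f (w + 2) f) N"
  proof (cases "N = 0")
    case True
    have "fps_nth (\<Sum>(r, s)\<in>?I. ?h r s) 0 = 0"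
      by (auto simp: fps_sum_nth fps_nth_0_zeta intro!: sum.neutral)
    moreover have "fps_nth (R_f (w + 2) f) 0 = 0" using R_f_nth[of w f 0] by simp
    ultimately show ?thesis using True F0 by (simp add: fps_nth_0_zeta)
  next
    case False
    hence N: "N > 0" by simp
    let ?P = "\<lambda>D d. period_poly_ev0 (w + 2) f (of_nat D) (of_nat d)"
    let ?O = "odd_pairs (w + 2)" and ?c = "period_coeff (w + 2) f"
    define \<sigma> :: complex where "\<sigma> = (\<Sum>d | d dvd N. of_nat d ^ (w + 1))"
    define T where "T = (\<Sum>D | D dvd N. \<Sum>(r, s)\<in>?O. ?c r s * (of_nat D ^ (s - 1) * half_power_sum r D))"
    \<comment> \<open>The leading Faulhaber terms add up to \<sigma> E. They enter
      \<open>lambda_f\<close> and are missing from \<open>R_f\<close>, so the two together restore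
      the full sum T.\<close>
    define E where "E = (\<Sum>(r, s)\<in>?O. ?c r s / (of_nat r * 2 ^ r))"
    have "fact w * fps_nth (\<Sum>(r, s)\<in>?I. ?h r s) N =
        (\<Sum>x\<in>?I. \<Sum>y\<in>manin_quads N. case x of (r, s) \<Rightarrow> case y of (m, n, D, d) \<Rightarrow>
            of_nat (w choose (r - 1)) * q r s * of_nat d ^ (r - 1) * of_nat (D - d) ^ (s - 1))"
      unfolding fps_sum_nth sum_distrib_left
    proof (rule sum.cong[OF refl])
      fix x assume "x \<in> ?I"
      then obtain r s where x: "x = (r, s)" "r + s = w + 2" "r \<ge> 2" "s \<ge> 2" by auto
      have rs: "r \<ge> 1" "s \<ge> 1" "w - (r - 1) = s - 1" "r - 1 \<le> w" using x by auto
      have b: "of_nat (w choose (r - 1)) = (fact w / (fact (r - 1) * fact (s - 1)) :: complex)"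
        using binomial_fact[OF rs(4), where 'a = complex] rs(3) by simp
      show "fact w * fps_nth (case x of (r, s) \<Rightarrow> ?h r s) N = (\<Sum>y\<in>manin_quads N. case x of (r, s) \<Rightarrow> case y of (m, n, D, d) \<Rightarrow>
            of_nat (w choose (r - 1)) * q r s * of_nat d ^ (r - 1) * of_nat (D - d) ^ (s - 1))"
        unfolding x(1) prod.case fps_mult_left_const_nth zeta_q_hat_complex_nth[OF rs(1,2)] b
        by (simp add: sum_distrib_left case_prod_unfold mult_ac)
    qed
    also have "\<dots> = (\<Sum>y\<in>manin_quads N. \<Sum>x\<in>?I. case x of (r, s) \<Rightarrow> case y of (m, n, D, d) \<Rightarrow>
            of_nat (w choose (r - 1)) * q r s * of_nat d ^ (r - 1) * of_nat (D - d) ^ (s - 1))"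
      by (rule sum.swap)
    also have "\<dots> = (\<Sum>(m, n, D, d)\<in>manin_quads N. ?P D d)"
    proof (rule sum.cong[OF refl])
      fix y assume y: "y \<in> manin_quads N"
      obtain m n D d where y': "y = (m, n, D, d)" by (cases y)
      have "of_nat d + of_nat (D - d) = (of_nat D :: complex)"
        using y unfolding y' manin_quads_def by (simp flip: of_nat_add)
      thus "(\<Sum>x\<in>?I. case x of (r, s) \<Rightarrow> case y of (m, n, D, d) \<Rightarrow>
            of_nat (w choose (r - 1)) * q r s * of_nat d ^ (r - 1) * of_nat (D - d) ^ (s - 1)) =
          (case y of (m, n, D, d) \<Rightarrow> ?P D d)"
        unfolding y' prod.case using inner_period_sum[OF q, of "of_nat d" "of_nat (D - d)"] by simp
    qed
    finally have H: "fact w * fps_nth (\<Sum>(r, s)\<in>?I. ?h r s) N = (\<Sum>(m, n, D, d)\<in>manin_quads N. ?P D d)" .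
    have lam: "lambda_f (w + 2) f = of_nat (w + 1) / 2 * (2 * E - completed_L f 1)"
    proof -
      have "(\<Sum>(r, s)\<in>?O. (-1) ^ ((s - 1) div 2) / (of_nat r * 2 ^ (r - 1)) * of_nat (w choose (s - 1))
           * completed_L f (of_nat s)) = 2 * E"
        unfolding E_def sum_distrib_left
      proof (rule sum.cong[OF refl])
        fix x assume "x \<in> ?O"
        then obtain r s where x: "x = (r, s)" "r \<ge> 3" by (auto simp: odd_pairs_def)
        have "(2 :: complex) ^ r = 2 * 2 ^ (r - 1)" using x(2) by (cases r) auto
        thus "(case x of (r, s) \<Rightarrow> (-1) ^ ((s - 1) div 2) / (of_nat r * 2 ^ (r - 1)) * of_nat (w choose (s - 1))
           * completed_L f (of_nat s)) = 2 * (case x of (r, s) \<Rightarrow> ?c r s / (of_nat r * 2 ^ r))"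
          unfolding x(1) prod.case period_coeff_def by simp
      qed
      thus ?thesis by (simp add: lambda_f_def)
    qed
    have "fps_nth (fps_of_rat (zeta_q (w + 2))) N = (\<Sum>d | d dvd N. of_nat d ^ (w + 2 - 1) / fact (w + 2 - 1))"
      by (rule zeta_q_complex_nth) (use N in auto)
    also have "\<dots> = \<sigma> / fact (w + 1)"
      by (simp add: \<sigma>_def sum_divide_distrib del: fact_Suc)
    also have "(fact (w + 1) :: complex) = of_nat (w + 1) * fact w" by simp
    finally have Z: "fps_nth (fps_of_rat (zeta_q (w + 2))) N = \<sigma> / (of_nat (w + 1) * fact w)" .
    have "g * (n / 2 * (2 * E - l) * (\<sigma> / (n * g))) = \<sigma> * E - l / 2 * \<sigma>"
      if "n \<noteq> 0" "g \<noteq> 0" for g n l :: complex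
      using that by (simp add: field_simps)
    from this[of "of_nat (w + 1)" "fact w" "completed_L f 1"]
    have "fact w * fps_nth ?z N = \<sigma> * E - completed_L f 1 / 2 * \<sigma>"
      unfolding fps_mult_left_const_nth lam Z by (simp only: of_nat_eq_0_iff fact_nonzero) simp
    moreover have "fact w * fps_nth (R_f (w + 2) f) N = T - \<sigma> * E"
    proof -
      have "fact w * fps_nth (R_f (w + 2) f) N = T -
          (\<Sum>D | D dvd N. \<Sum>(r, s)\<in>?O. ?c r s * (of_nat D ^ (s - 1) * (of_nat D ^ r / (of_nat r * 2 ^ r))))"
        unfolding R_f_nth T_def using N
        by (simp add: right_diff_distrib sum_subtractf case_prod_unfold)
      also have "(\<Sum>D | D dvd N. \<Sum>(r, s)\<in>?O. ?c r s * (of_nat D ^ (s - 1) * (of_nat D ^ r / (of_nat r * 2 ^ r)))) = \<sigma> * E"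
        unfolding \<sigma>_def sum_distrib_right
      proof (rule sum.cong[OF refl])
        fix D
        show "(\<Sum>(r, s)\<in>?O. ?c r s * (of_nat D ^ (s - 1) * (of_nat D ^ r / (of_nat r * 2 ^ r)))) = of_nat D ^ (w + 1) * E"
          unfolding E_def sum_distrib_left
        proof (rule sum.cong[OF refl])
          fix x assume "x \<in> ?O"
          then obtain r s where x: "x = (r, s)" "w + 1 = (s - 1) + r" by (auto simp: odd_pairs_def)
          show "(case x of (r, s) \<Rightarrow> ?c r s * (of_nat D ^ (s - 1) * (of_nat D ^ r / (of_nat r * 2 ^ r)))) =
              of_nat D ^ (w + 1) * (case x of (r, s) \<Rightarrow> ?c r s / (of_nat r * 2 ^ r))"
            unfolding x(1) x(2) prod.case power_add by simp
        qed
      qed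
      finally show ?thesis .
    qed
    ultimately have "fact w * fps_nth ((\<Sum>(r, s)\<in>?I. ?h r s) - ?z - R_f (w + 2) f) N = completed_L f 1 / 2 * fps_nth F N"
      using H coefficient_period_formula[OF N] unfolding T_def[symmetric] \<sigma>_def[symmetric]
      by (simp only: fps_sub_nth right_diff_distrib) simp
    also have "\<dots> = fact w * fps_nth ?lhs N"
      by simp
    finally show ?thesis by (simp only: mult_cancel_left) simp
  qed
qed

theorem theorem1p1:
  fixes k :: nat and f :: "complex \<Rightarrow> complex" and q :: "nat \<Rightarrow> nat \<Rightarrow> complex"
  assumes "even k" and "k > 0"
    and "f \<in> cusp_forms k"
    and "\<exists>\<tau>\<in>upper_half_plane. f \<tau> \<noteq> 0"
    and "\<And>n \<tau>. n \<ge> 1 \<Longrightarrow> \<tau> \<in> upper_half_plane \<Longrightarrow>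
           hecke k n f \<tau> = fps_nth (q_expansion f) n * f \<tau>"
    and "\<And>X Y. period_poly_ev0 k f (X + Y) X =
           (\<Sum>(r, s)\<in>{(r, s). r + s = k \<and> r \<ge> 1 \<and> s \<ge> 1}.
              of_nat ((k - 2) choose (r - 1)) * q r s * X ^ (r - 1) * Y ^ (s - 1))"
  shows "fps_const (completed_L f 1 / (2 * fact (k - 2))) * q_expansion f =
           (\<Sum>(r, s)\<in>{(r, s). r + s = k \<and> r \<ge> 2 \<and> s \<ge> 2}.
              fps_const (q r s) * fps_of_rat (zeta_q_hat r s))
           - fps_const (lambda_f k f) * fps_of_rat (zeta_q k)
           - R_f k f"
proof -
  obtain j where "k = 2 * j" using assms(1) by (rule evenE)
  then obtain i where "k = 2 * i + 2" using assms(2) by (cases j) auto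
  then obtain w where k: "k = w + 2" "even w" by auto
  interpret cusp_eigenform w f
    by unfold_locales (use assms(3,5) k in \<open>auto simp: upper_half_plane_def\<close>)
  show ?thesis
    using eigenform_double_zeta_formula[of q] assms(6) unfolding k(1) by simp
qed

end
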